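(* Let $M=\{V_i\}$ be the dead leaves model associated with a random closed set $X$ of $\mathbb{R}^2$ satisfying (C-1) and (C-2), $V_i$ being its visible parts. For $n\ge 1$ and non-empty compact sets $K_1,\dots,K_n\subset\mathbb{R}^2$, put $\underline{K}_j=\bigcup_{k=1}^{j}K_k$ and $$Q^{(n)}(K_1,\dots,K_n)=\Pr\left(\exists\, t_{i_1}<\dots<t_{i_n}\text{ such that }K_1\subset \mathring V_{i_1},\ \dots,\ K_n\subset\mathring V_{i_n}\right),$$ $$F_X^{(n)}(K_1,\dots,K_n)=E\,\nu(\mathring X\ominus\check K_1)\prod_{j=2}^{n}E\,\nu\left((\mathring X\ominus\check K_j)\cap (X\oplus\check{\underline{K}}_{j-1})^{c}\right),$$ $$G_X^{(n)}(K_1,\dots,K_n)=\prod_{j=1}^{n}E\,\nu\left(X\oplus\check{\underline{K}}_{j}\right).$$ Then the probability that $K_1,\dots,K_n$ are sequentially included in $n$ distinct visible parts is $$Q^{(n)}(K_1,\dots,K_n)=\frac{F_X^{(n)}(K_1,\dots,K_n)}{G_X^{(n)}(K_1,\dots,K_n)}.$$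
   Context: $\nu$ is Lebesgue measure on $\mathbb{R}^2$, $\mathring A$ is the interior of $A$, $A^c$ the complement. For sets $A,B\subset\mathbb{R}^2$: $\check A=\{-x:x\in A\}$, $A\ominus B=\{x\in\mathbb{R}^2: x+\check B\subset A\}$, $A\oplus B=\{x+y:x\in A,y\in B\}$. A random closed set is a random element of the space of closed sets of $\mathbb{R}^2$ with the Borel $\sigma$-field of the Fell topology. Conditions on $X$: (C-1) $E\,\nu(X\oplus K)<\infty$ for every compact $K$; (C-2) there is a disk $D$ with positive radius such that $E\,\nu(X\ominus D)>0$. Dead leaves model: let $\{(x_i,t_i)\}$ be a homogeneous Poisson point process of intensity one on $\mathbb{R}^2\times\mathbb{R}$ and $(X_i)$ i.i.d. copies of $X$, independent of it. Only points with $t_i\le 0$ are used. The sets $x_i+X_i$ are called leaves, and the visible parts are $$V_i=(x_i+X_i)\setminus\bigcup_{t_j\in(t_i,0)}(x_j+\mathring X_j),\qquad t_i\le 0 .$$ $M=\{V_i\}$ is the dead leaves model associated with $X$.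
   Formalization: The formal theorem additionally assumes that X is almost surely the closure of its interior; without this the formula fails, e.g. for n = 1, X a unit disk together with a distant segment and K_1 a smaller disk, where Q exceeds F/G. *)

theory Defs
  imports "HOL-Probability.Probability"
begin

subsection \<open>Random closed sets\<close>

text \<open>The sets with \<open>K = {}\<close> make the whole space equal to the closed sets, including \<open>{}\<close>.\<close>

definition fell_topology :: "'a::topological_space set topology" where
  "fell_topology = topology_generated_by
     ({{F. closed F \<and> F \<inter> K = {}} |K. compact K} \<union>
      {{F. closed F \<and> F \<inter> U \<noteq> {}} |U. open U})"

lemma topspace_fell_topology: "topspace fell_topology = {F. closed F}"
proof -
  have "{F::'a set. closed F} \<in> {{F. closed F \<and> F \<inter> K = {}} |K. compact K}"
    by (rule CollectI, rule exI[of _ "{}"]) auto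
  then show ?thesis
    unfolding fell_topology_def topology_generated_by_topspace by auto
qed

definition fell_borel :: "'a::topological_space set measure" where
  "fell_borel = sigma {F. closed F} {S. openin fell_topology S}"

lemma space_fell_borel: "space fell_borel = {F. closed F}"
  unfolding fell_borel_def by (rule space_measure_of_conv)

lemma sets_fell_borel: "sets fell_borel = sigma_sets {F. closed F} {S. openin fell_topology S}"
  unfolding fell_borel_def
  by (rule sets_measure_of) (use openin_subset topspace_fell_topology in blast)

definition random_closed_set :: "'p measure \<Rightarrow> ('p \<Rightarrow> 'a::topological_space set) \<Rightarrow> bool" where
  "random_closed_set P X \<longleftrightarrow> prob_space P \<and> X \<in> measurable P fell_borel"


subsection \<open>Set operations and mean areas\<close>

text \<open>Minkowski addition \<open>A \<oplus> B\<close> is \<open>A + B\<close> from \<open>HOL-Library.Set_Algebras\<close>.\<close>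

definition reflection :: "'a::ab_group_add set \<Rightarrow> 'a set" where
  "reflection A = uminus ` A"

definition erosion :: "'a::ab_group_add set \<Rightarrow> 'a set \<Rightarrow> 'a set" (infixl "\<ominus>" 65) where
  "A \<ominus> B = {x. (+) x ` reflection B \<subseteq> A}"

definition mean_area :: "'p measure \<Rightarrow> ('p \<Rightarrow> (real^2) set) \<Rightarrow> ennreal" where
  "mean_area P Y = (\<integral>\<^sup>+ \<omega>. emeasure lborel (Y \<omega>) \<partial>P)"

definition condition_C1 :: "'p measure \<Rightarrow> ('p \<Rightarrow> (real^2) set) \<Rightarrow> bool" where
  "condition_C1 P X \<longleftrightarrow> (\<forall>K. compact K \<longrightarrow> mean_area P (\<lambda>\<omega>. X \<omega> + K) < \<infinity>)"

definition condition_C2 :: "'p measure \<Rightarrow> ('p \<Rightarrow> (real^2) set) \<Rightarrow> bool" where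
  "condition_C2 P X \<longleftrightarrow> (\<exists>c r. 0 < r \<and> 0 < mean_area P (\<lambda>\<omega>. X \<omega> \<ominus> cball c r))"


subsection \<open>The dead leaves model\<close>

text \<open>
  A Poisson point process with intensity measure \<open>\<mu>\<close>, given by an enumeration \<open>Z\<close> of its points;
  for an infinite \<open>\<mu>\<close> there are almost surely infinitely many points. The explicit finiteness
  clause is needed because \<open>card\<close> maps infinite sets to \<open>0\<close>.
\<close>

definition poisson_process :: "'w measure \<Rightarrow> 'a measure \<Rightarrow> (nat \<Rightarrow> 'w \<Rightarrow> 'a) \<Rightarrow> bool" where
  "poisson_process M \<mu> Z \<longleftrightarrow>
     (\<forall>i. Z i \<in> measurable M \<mu>) \<and>
     (\<forall>A \<in> sets \<mu>. emeasure \<mu> A < \<infinity> \<longrightarrow>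
        (AE \<omega> in M. finite {i. Z i \<omega> \<in> A}) \<and>
        (\<forall>k. measure M {\<omega> \<in> space M. card {i. Z i \<omega> \<in> A} = k} =
             exp (- measure \<mu> A) * measure \<mu> A ^ k / fact k)) \<and>
     (\<forall>(m::nat) A. disjoint_family_on A {..<m} \<longrightarrow>
        (\<forall>l<m. A l \<in> sets \<mu> \<and> emeasure \<mu> (A l) < \<infinity>) \<longrightarrow>
        prob_space.indep_vars M (\<lambda>_. count_space UNIV)
          (\<lambda>l \<omega>. card {i. Z i \<omega> \<in> A l}) {..<m})"

text \<open>
  The leaf shapes \<open>L i\<close> are i.i.d. copies of \<open>X\<close>, and the sequence of shapes is independent of the
  sequence of points \<open>(x i, t i)\<close>.
\<close>

definition dead_leaves_model ::
  "'w measure \<Rightarrow> (nat \<Rightarrow> 'w \<Rightarrow> real^2) \<Rightarrow> (nat \<Rightarrow> 'w \<Rightarrow> real) \<Rightarrow> (nat \<Rightarrow> 'w \<Rightarrow> (real^2) set) \<Rightarrow>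
   'p measure \<Rightarrow> ('p \<Rightarrow> (real^2) set) \<Rightarrow> bool" where
  "dead_leaves_model M x t L P X \<longleftrightarrow>
     prob_space M \<and>
     poisson_process M lborel (\<lambda>i \<omega>. (x i \<omega>, t i \<omega>)) \<and>
     (\<forall>i. random_closed_set M (L i) \<and> distr M fell_borel (L i) = distr P fell_borel X) \<and>
     prob_space.indep_vars M (\<lambda>_. fell_borel) L UNIV \<and>
     prob_space.indep_set M
       {(\<lambda>\<omega> i. (x i \<omega>, t i \<omega>)) -` A \<inter> space M |A. A \<in> sets (\<Pi>\<^sub>M i\<in>UNIV. lborel)}
       {(\<lambda>\<omega> i. L i \<omega>) -` B \<inter> space M |B. B \<in> sets (\<Pi>\<^sub>M i\<in>UNIV. fell_borel)}"

text \<open>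
  Only the interiors of later leaves are removed. If \<open>X\<close> is not the closure of its interior (for example
  a disk together with a segment), a later leaf can hit a compact set without affecting the visible
  parts around it, and hitting probabilities computed from \<open>X\<close> are then too large. Hence formulas
  for visible parts in terms of \<open>X + K\<close> require \<open>closure (interior (X \<omega>)) = X \<omega>\<close> almost surely.
\<close>

definition visible_part ::
  "(nat \<Rightarrow> 'w \<Rightarrow> real^2) \<Rightarrow> (nat \<Rightarrow> 'w \<Rightarrow> real) \<Rightarrow> (nat \<Rightarrow> 'w \<Rightarrow> (real^2) set) \<Rightarrow>
   nat \<Rightarrow> 'w \<Rightarrow> (real^2) set" where
  "visible_part x t L i \<omega> =
     (+) (x i \<omega>) ` L i \<omega> - (\<Union>j \<in> {j. t j \<omega> \<in> {t i \<omega> <..< 0}}. (+) (x j \<omega>) ` interior (L j \<omega>))"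


subsection \<open>Sequential inclusion\<close>

definition inclusion_event ::
  "'w measure \<Rightarrow> (nat \<Rightarrow> 'w \<Rightarrow> real^2) \<Rightarrow> (nat \<Rightarrow> 'w \<Rightarrow> real) \<Rightarrow> (nat \<Rightarrow> 'w \<Rightarrow> (real^2) set) \<Rightarrow>
   nat \<Rightarrow> (nat \<Rightarrow> (real^2) set) \<Rightarrow> 'w set" where
  "inclusion_event M x t L n K =
     {\<omega> \<in> space M. \<exists>i :: nat \<Rightarrow> nat.
        strict_mono_on {1..n} (\<lambda>j. t (i j) \<omega>) \<and>
        (\<forall>j\<in>{1..n}. t (i j) \<omega> \<le> 0 \<and> K j \<subseteq> interior (visible_part x t L (i j) \<omega>))}"

definition Q_prob ::
  "'w measure \<Rightarrow> (nat \<Rightarrow> 'w \<Rightarrow> real^2) \<Rightarrow> (nat \<Rightarrow> 'w \<Rightarrow> real) \<Rightarrow> (nat \<Rightarrow> 'w \<Rightarrow> (real^2) set) \<Rightarrow>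
   nat \<Rightarrow> (nat \<Rightarrow> (real^2) set) \<Rightarrow> ennreal" where
  "Q_prob M x t L n K = emeasure M (inclusion_event M x t L n K)"

definition cumulative_union :: "(nat \<Rightarrow> 'a set) \<Rightarrow> nat \<Rightarrow> 'a set" where
  "cumulative_union K j = (\<Union>k\<in>{1..j}. K k)"

definition F_fun ::
  "'p measure \<Rightarrow> ('p \<Rightarrow> (real^2) set) \<Rightarrow> nat \<Rightarrow> (nat \<Rightarrow> (real^2) set) \<Rightarrow> ennreal" where
  "F_fun P X n K =
     mean_area P (\<lambda>\<omega>. interior (X \<omega>) \<ominus> reflection (K 1)) *
     (\<Prod>j = 2..n. mean_area P (\<lambda>\<omega>.
        (interior (X \<omega>) \<ominus> reflection (K j)) \<inter>
        - (X \<omega> + reflection (cumulative_union K (j - 1)))))"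

definition G_fun ::
  "'p measure \<Rightarrow> ('p \<Rightarrow> (real^2) set) \<Rightarrow> nat \<Rightarrow> (nat \<Rightarrow> (real^2) set) \<Rightarrow> ennreal" where
  "G_fun P X n K =
     (\<Prod>j = 1..n. mean_area P (\<lambda>\<omega>. X \<omega> + reflection (cumulative_union K j)))"

end

theory Submission
  imports Defs "HOL-Real_Asymp.Real_Asymp"
begin

text \<open>
  Look backwards in time from \<open>0\<close> and, for each \<open>k\<close>, consider the most recent leaf that hits
  \<open>K 1 \<union> \<dots> \<union> K k\<close>. Since leaves are closures of their interiors, a leaf that hits a compact set
  spoils it for every older leaf: the set cannot lie in the interior of an older visible part.
  Hence the inclusion event holds, up to a null set, exactly if for every \<open>k\<close> the most recent leaf
  hitting \<open>K 1 \<union> \<dots> \<union> K k\<close> covers \<open>K k\<close> by its interior and misses \<open>K 1 \<union> \<dots> \<union> K (k - 1)\<close>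
  (\<open>inclusion_iff_latest_chain\<close>; the null set collects coinciding times, a leaf at time \<open>0\<close>,
  irregular leaves, and infinitely many leaves near the compact sets in bounded time).

  Call the two kinds of leaves \<open>H k\<close> and \<open>G k \<subseteq> H k\<close>. The most recent leaf of kind \<open>H k\<close> is of
  kind \<open>G k\<close> with probability \<open>|G k| / |H k|\<close>, where \<open>| |\<close> is Lebesgue measure times the law of
  \<open>X\<close>; then the process starts afresh before that leaf, and so the probabilities multiply
  (\<open>latest_chain_probability\<close>). By Fubini and a reflection, \<open>|G k|\<close> and \<open>|H k|\<close> are the mean
  areas in the formula.

  The renewal step is made without stopping times. For the Poisson process with marks, the
  probability that a set of finite measure \<open>m\<close> contains no marked point is \<open>exp (- m)\<close>
  (\<open>void_probability\<close>), and these void probabilities are all that is used. Cut the past into slots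
  of length \<open>d\<close>, and require that the first slot with a leaf of kind \<open>H k\<close> has no leaf of kind
  \<open>H k - G k\<close>, and that the search for kind \<open>H (k - 1)\<close> starts in the slot before. This
  event is a disjoint union of differences of void events, so its probability is a product of
  geometric series (\<open>slotted_event_probability\<close>). As \<open>d\<close> tends to \<open>0\<close>, the slotted events
  converge almost surely to the event about the most recent leaves.
\<close>

section \<open>Product functionals of a Poisson process\<close>

lemma poisson_count_measurable:
  assumes "prob_space M" "poisson_process M \<mu> Z" "A \<in> sets \<mu>" "emeasure \<mu> A < \<infinity>"
  shows "(\<lambda>\<omega>. card {i. Z i \<omega> \<in> A}) \<in> measurable M (count_space UNIV)"
proof -
  have "prob_space.indep_vars M (\<lambda>_. count_space UNIV)
      (\<lambda>l \<omega>. card {i. Z i \<omega> \<in> (\<lambda>_. A) l}) {..<(1::nat)}"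
    using assms(2-4) unfolding poisson_process_def
    by (elim conjE allE[of _ "1::nat"] allE[of _ "\<lambda>_::nat. A"])
       (auto simp: disjoint_family_on_def)
  then show ?thesis
    using assms(1) by (auto simp: prob_space.indep_vars_def)
qed

lemma poisson_count_generating_function:
  assumes M: "prob_space M" and pp: "poisson_process M \<mu> Z"
    and A: "A \<in> sets \<mu>" "emeasure \<mu> A < \<infinity>" and c: "0 \<le> c"
  shows "(\<integral>\<^sup>+\<omega>. ennreal (c ^ card {i. Z i \<omega> \<in> A}) \<partial>M) = ennreal (exp (- (1 - c) * measure \<mu> A))"
proof -
  interpret prob_space M by fact
  let ?N = "\<lambda>\<omega>. card {i. Z i \<omega> \<in> A}" and ?m = "measure \<mu> A"
  have N[measurable]: "?N \<in> measurable M (count_space UNIV)"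
    by (rule poisson_count_measurable[OF M pp A])
  have law: "measure M {\<omega> \<in> space M. ?N \<omega> = k} = exp (- ?m) * ?m ^ k / fact k" for k
    using pp A unfolding poisson_process_def by blast
  have "(\<integral>\<^sup>+\<omega>. ennreal (c ^ ?N \<omega>) \<partial>M) =
      (\<integral>\<^sup>+\<omega>. (\<Sum>k. ennreal (c ^ k) * indicator {\<omega> \<in> space M. ?N \<omega> = k} \<omega>) \<partial>M)"
  proof (rule nn_integral_cong)
    fix \<omega> assume "\<omega> \<in> space M"
    then show "ennreal (c ^ ?N \<omega>) = (\<Sum>k. ennreal (c ^ k) * indicator {\<omega> \<in> space M. ?N \<omega> = k} \<omega>)"
      by (subst suminf_finite[of "{?N \<omega>}"]) (auto simp: indicator_def)
  qed
  also have "\<dots> = (\<Sum>k. ennreal (c ^ k) * emeasure M {\<omega> \<in> space M. ?N \<omega> = k})"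
    by (subst nn_integral_suminf) (auto simp: nn_integral_cmult_indicator)
  also have "\<dots> = (\<Sum>k. ennreal (exp (- ?m) * ((c * ?m) ^ k /\<^sub>R fact k)))"
    using c by (intro suminf_cong)
      (simp add: emeasure_eq_measure law ennreal_mult[symmetric] power_mult_distrib field_simps)
  also have "\<dots> = ennreal (exp (- ?m) * exp (c * ?m))"
    using c by (intro suminf_ennreal_eq sums_mult exp_converges) auto
  also have "exp (- ?m) * exp (c * ?m) = exp (- (1 - c) * ?m)"
    by (simp add: exp_add[symmetric] algebra_simps)
  finally show ?thesis .
qed

lemma INF_eventually_const:
  fixes X :: "nat \<Rightarrow> ennreal"
  assumes "decseq X" "\<And>n. n \<ge> n0 \<Longrightarrow> X n = c"
  shows "(INF n. X n) = c"
  using LIMSEQ_INF[OF assms(1)] LIMSEQ_unique tendsto_eventually[of X c sequentially] assms(2)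
  by (metis (mono_tags, lifting) eventually_sequentiallyI)

lemma decseq_prod_le_1:
  fixes f :: "nat \<Rightarrow> real"
  assumes "\<And>i. 0 \<le> f i" "\<And>i. f i \<le> 1"
  shows "decseq (\<lambda>n. ennreal (\<Prod>i<n. f i))"
  using assms by (intro decseq_SucI ennreal_leI) (simp add: mult_left_le prod_nonneg)

text \<open>
  The number of points in \<open>A l\<close> turns the infinite product into
  \<open>\<Prod>l<m. c l ^ card {i. Z i \<omega> \<in> A l}\<close>; the counts are independent, so their generating functions
  multiply. The infimum over the partial products stands for the infinite product, which decreases
  because all factors lie in \<open>[0, 1]\<close>.
\<close>

lemma poisson_process_product_step_function:
  fixes c :: "nat \<Rightarrow> real" and Z :: "nat \<Rightarrow> 'w \<Rightarrow> 'a"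
  assumes M: "prob_space M" and pp: "poisson_process M \<mu> Z"
    and disj: "disjoint_family_on A {..<m}"
    and A: "\<And>l. l < m \<Longrightarrow> A l \<in> sets \<mu>" "\<And>l. l < m \<Longrightarrow> emeasure \<mu> (A l) < \<infinity>"
    and c: "\<And>l. l < m \<Longrightarrow> 0 \<le> c l" "\<And>l. l < m \<Longrightarrow> c l \<le> 1"
    and fc: "\<And>l z. l < m \<Longrightarrow> z \<in> A l \<Longrightarrow> f z = c l"
    and f1: "\<And>z. z \<in> space \<mu> \<Longrightarrow> z \<notin> (\<Union>l<m. A l) \<Longrightarrow> f z = (1::real)"
  shows "(\<integral>\<^sup>+\<omega>. (INF n. ennreal (\<Prod>i<n. f (Z i \<omega>))) \<partial>M) =
    ennreal (exp (- (\<Sum>l<m. (1 - c l) * measure \<mu> (A l))))"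
proof -
  interpret prob_space M by fact
  let ?N = "\<lambda>l \<omega>. card {i. Z i \<omega> \<in> A l}"
  have Z: "Z i \<omega> \<in> space \<mu>" if "\<omega> \<in> space M" for i \<omega>
    using pp that unfolding poisson_process_def by (meson measurable_space)
  have "AE \<omega> in M. \<forall>l\<in>{..<m}. finite {i. Z i \<omega> \<in> A l}"
    by (intro AE_finite_allI) (use pp A in \<open>auto simp: poisson_process_def\<close>)
  then have "AE \<omega> in M. (INF n. ennreal (\<Prod>i<n. f (Z i \<omega>))) = (\<Prod>l<m. ennreal (c l ^ ?N l \<omega>))"
    using AE_space
  proof eventually_elim
    fix \<omega> assume sp: "\<omega> \<in> space M" and fin: "\<forall>l\<in>{..<m}. finite {i. Z i \<omega> \<in> A l}"
    show "(INF n. ennreal (\<Prod>i<n. f (Z i \<omega>))) = (\<Prod>l<m. ennreal (c l ^ ?N l \<omega>))"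
    proof (rule INF_eventually_const)
      define J where "J l = {i. Z i \<omega> \<in> A l}" for l
      have finJ: "finite (\<Union>l<m. J l)" using fin by (auto simp: J_def)
      have disjJ: "J k \<inter> J l = {}" if "k < m" "l < m" "k \<noteq> l" for k l
        using disj that by (fastforce simp: J_def disjoint_family_on_def)
      have f_out: "f (Z i \<omega>) = 1" if "i \<notin> (\<Union>l<m. J l)" for i
        using f1[OF Z[OF sp], of i] that by (auto simp: J_def)
      have f_in: "f (Z i \<omega>) = c l" if "i \<in> J l" "l < m" for i l
        using fc that by (auto simp: J_def)
      have "0 \<le> f (Z i \<omega>) \<and> f (Z i \<omega>) \<le> 1" for i
        using f_out[of i] f_in[of i] c by (cases "i \<in> (\<Union>l<m. J l)") auto
      then show "decseq (\<lambda>n. ennreal (\<Prod>i<n. f (Z i \<omega>)))"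
        by (intro decseq_prod_le_1) auto
      fix n assume n: "Suc (Max (insert 0 (\<Union>l<m. J l))) \<le> n"
      have sub: "(\<Union>l<m. J l) \<subseteq> {..<n}"
      proof
        fix i assume "i \<in> (\<Union>l<m. J l)"
        then have "i \<le> Max (insert 0 (\<Union>l<m. J l))" using finJ by (intro Max_ge) auto
        then show "i \<in> {..<n}" using n by simp
      qed
      have "(\<Prod>i<n. f (Z i \<omega>)) = (\<Prod>i\<in>(\<Union>l<m. J l). f (Z i \<omega>))"
        by (intro prod.mono_neutral_right sub) (use f_out in auto)
      also have "\<dots> = (\<Prod>l<m. \<Prod>i\<in>J l. f (Z i \<omega>))"
        by (intro prod.UNION_disjoint) (use fin disjJ in \<open>auto simp: J_def\<close>)
      also have "\<dots> = (\<Prod>l<m. c l ^ card (J l))"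
        by (intro prod.cong refl) (simp add: f_in)
      finally show "ennreal (\<Prod>i<n. f (Z i \<omega>)) = (\<Prod>l<m. ennreal (c l ^ ?N l \<omega>))"
        using c by (subst prod_ennreal) (auto simp: J_def)
    qed
  qed
  then have "(\<integral>\<^sup>+\<omega>. (INF n. ennreal (\<Prod>i<n. f (Z i \<omega>))) \<partial>M) =
      (\<integral>\<^sup>+\<omega>. (\<Prod>l<m. ennreal (c l ^ ?N l \<omega>)) \<partial>M)"
    by (rule nn_integral_cong_AE)
  also have "\<dots> = (\<Prod>l<m. \<integral>\<^sup>+\<omega>. ennreal (c l ^ ?N l \<omega>) \<partial>M)"
  proof (rule indep_vars_nn_integral)
    have "indep_vars (\<lambda>_. count_space UNIV) ?N {..<m}"
      using pp disj A unfolding poisson_process_def by blast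
    then show "indep_vars (\<lambda>_. borel) (\<lambda>l \<omega>. ennreal (c l ^ ?N l \<omega>)) {..<m}"
      by (rule indep_vars_compose2[where Y="\<lambda>l k. ennreal (c l ^ k)"]) auto
  qed auto
  also have "\<dots> = (\<Prod>l<m. ennreal (exp (- (1 - c l) * measure \<mu> (A l))))"
    by (intro prod.cong refl poisson_count_generating_function[OF M pp]) (use A c in auto)
  also have "\<dots> = ennreal (exp (- (\<Sum>l<m. (1 - c l) * measure \<mu> (A l))))"
    by (subst prod_ennreal) (auto simp: exp_sum[symmetric] sum_negf[symmetric] algebra_simps)
  finally show ?thesis .
qed

lemma poisson_process_product_simple:
  fixes Z :: "nat \<Rightarrow> 'w \<Rightarrow> 'a"
  assumes M: "prob_space M" and pp: "poisson_process M \<mu> Z"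
    and f: "simple_function \<mu> f" "\<And>z. 0 \<le> f z" "\<And>z. f z \<le> (1::real)"
    and fin: "emeasure \<mu> {z \<in> space \<mu>. f z \<noteq> 0} < \<infinity>"
  shows "(\<integral>\<^sup>+\<omega>. (INF n. ennreal (\<Prod>i<n. 1 - f (Z i \<omega>))) \<partial>M) =
    ennreal (exp (- (\<integral>z. f z \<partial>\<mu>)))"
proof -
  define V where "V = f ` space \<mu> - {0}"
  have V: "finite V" using f(1) by (auto simp: V_def simple_function_def)
  then obtain e where e: "bij_betw e {0..<card V} V" using ex_bij_betw_nat_finite by blast
  define m where "m = card V"
  define A where "A l = f -` {e l} \<inter> space \<mu>" for l
  have e': "bij_betw e {..<m} V" using e by (simp add: m_def atLeast0LessThan)
  have eV: "e l \<in> V" if "l < m" for l using e' that by (auto simp: bij_betw_def)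
  have A_sets: "A l \<in> sets \<mu>" for l
    unfolding A_def by (rule simple_functionD(2)[OF f(1)])
  have "emeasure \<mu> (A l) \<le> emeasure \<mu> {z \<in> space \<mu>. f z \<noteq> 0}" if "l < m" for l
    by (intro emeasure_mono) (use eV[OF that] f(1) in \<open>auto simp: A_def V_def\<close>)
  then have A_fin: "emeasure \<mu> (A l) < \<infinity>" if "l < m" for l
    using fin that by (meson le_less_trans)
  have int: "integrable \<mu> (\<lambda>z. indicator (A l) z :: real)" if "l < m" for l
    using A_sets A_fin that by (simp add: integrable_indicator_iff)
  have "(\<integral>\<^sup>+\<omega>. (INF n. ennreal (\<Prod>i<n. 1 - f (Z i \<omega>))) \<partial>M) =
    ennreal (exp (- (\<Sum>l<m. (1 - (1 - e l)) * measure \<mu> (A l))))"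
  proof (rule poisson_process_product_step_function[OF M pp])
    show "disjoint_family_on A {..<m}"
      using e' by (auto simp: disjoint_family_on_def A_def bij_betw_def inj_on_def)
    fix z assume "z \<in> space \<mu>" and nz: "z \<notin> (\<Union>l<m. A l)"
    moreover have "V = e ` {..<m}" using e' by (simp add: bij_betw_def)
    ultimately have "f z \<notin> V" by (auto simp: A_def)
    then show "1 - f z = 1" using \<open>z \<in> space \<mu>\<close> by (auto simp: V_def)
  next
    show "0 \<le> 1 - e l" "1 - e l \<le> 1" if "l < m" for l
      using eV[OF that] f(2,3) by (auto simp: V_def)
  qed (use A_sets A_fin in \<open>auto simp: A_def\<close>)
  also have "(\<Sum>l<m. (1 - (1 - e l)) * measure \<mu> (A l)) = (\<Sum>l<m. \<integral>z. e l * indicator (A l) z \<partial>\<mu>)"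
    using A_fin A_sets by (intro sum.cong) (auto)
  also have "\<dots> = (\<integral>z. (\<Sum>l<m. e l * indicator (A l) z) \<partial>\<mu>)"
    using int by (subst Bochner_Integration.integral_sum) auto
  also have "\<dots> = (\<integral>z. f z \<partial>\<mu>)"
  proof (rule Bochner_Integration.integral_cong[OF refl])
    fix z assume z: "z \<in> space \<mu>"
    have "(\<Sum>l<m. e l * indicator (A l) z) = (\<Sum>v\<in>V. v * indicator (f -` {v} \<inter> space \<mu>) z)"
      unfolding A_def by (rule sum.reindex_bij_betw[OF e'])
    also have "\<dots> = (\<Sum>v\<in>V. if v = f z then v else 0)"
      using z by (intro sum.cong) (auto simp: indicator_def)
    also have "\<dots> = f z" using z V by (auto simp: V_def sum.delta)
    finally show "(\<Sum>l<m. e l * indicator (A l) z) = f z" .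
  qed
  finally show ?thesis .
qed

text \<open>
  Exhausting \<open>f\<close> from below by simple functions turns both the partial products and the
  expectations into decreasing sequences, so the two infima may be exchanged and monotone
  convergence applies.
\<close>

lemma poisson_process_product:
  fixes Z :: "nat \<Rightarrow> 'w \<Rightarrow> 'a"
  assumes M: "prob_space M" and pp: "poisson_process M \<mu> Z"
    and f: "integrable \<mu> f" "\<And>z. 0 \<le> f z" "\<And>z. f z \<le> (1::real)"
  shows "(\<integral>\<^sup>+\<omega>. (INF n. ennreal (\<Prod>i<n. 1 - f (Z i \<omega>))) \<partial>M) =
    ennreal (exp (- (\<integral>z. f z \<partial>\<mu>)))"
proof -
  interpret prob_space M by fact
  have Z[measurable]: "Z i \<in> measurable M \<mu>" for i
    using pp unfolding poisson_process_def by blast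
  have [measurable]: "f \<in> borel_measurable \<mu>" using f(1) by simp
  obtain U :: "nat \<Rightarrow> 'a \<Rightarrow> ennreal" where U: "\<And>k. simple_function \<mu> (U k)" "incseq U"
    "\<And>k z. U k z < top" "\<And>z. (SUP k. U k z) = ennreal (f z)"
    by (rule borel_measurable_implies_simple_function_sequence'[of "\<lambda>z. ennreal (f z)" \<mu>])
      (auto simp: image_def)
  define g where "g k z = enn2real (U k z)" for k z
  have g_simple: "simple_function \<mu> (g k)" for k
    unfolding g_def using U(1) by (rule simple_function_compose1)
  have U_le: "U k z \<le> ennreal (f z)" for k z
    unfolding U(4)[symmetric] by (rule SUP_upper) simp
  have g: "0 \<le> g k z" "g k z \<le> f z" "g k z \<le> 1" for k z
  proof -
    show "0 \<le> g k z" by (simp add: g_def)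
    show "g k z \<le> f z" unfolding g_def using U_le f(2) by (intro enn2real_leI) auto
    then show "g k z \<le> 1" using f(3)[of z] by simp
  qed
  have g_incr: "g k z \<le> g (Suc k) z" for k z
    unfolding g_def using U(2,3) by (intro enn2real_mono) (auto simp: incseq_Suc_iff le_fun_def)
  have g_lim: "(\<lambda>k. g k z) \<longlonglongrightarrow> f z" for z
  proof -
    have "(\<lambda>k. U k z) \<longlonglongrightarrow> ennreal (f z)"
      using LIMSEQ_SUP[of "\<lambda>k. U k z"] U(2,4) by (auto simp: mono_def le_fun_def)
    then have "(\<lambda>k. enn2real (U k z)) \<longlonglongrightarrow> enn2real (ennreal (f z))"
      by (intro tendsto_enn2real) auto
    then show ?thesis using f(2) by (simp add: g_def)
  qed
  have [measurable]: "g k \<in> borel_measurable \<mu>" for k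
    using g_simple by (rule borel_measurable_simple_function)
  let ?P = "\<lambda>h n \<omega>. ennreal (\<Prod>i<n. 1 - h (Z i \<omega>))"
  have int_g: "integrable \<mu> (g k)" for k
    using f(1) by (rule Bochner_Integration.integrable_bound) (use g f(2) in \<open>auto simp: order_trans\<close>)
  have fin: "emeasure \<mu> {z \<in> space \<mu>. g k z \<noteq> 0} < \<infinity>" for k
  proof -
    have "(\<integral>\<^sup>+z. U k z \<partial>\<mu>) \<le> (\<integral>\<^sup>+z. ennreal (f z) \<partial>\<mu>)"
      by (intro nn_integral_mono U_le)
    also have "\<dots> < \<infinity>"
      using nn_integral_eq_integral[OF f(1)] f(2) by simp
    finally have "emeasure \<mu> {z \<in> space \<mu>. U k z \<noteq> 0} \<noteq> \<infinity>"
      using simple_function_finite_support[OF U(1)] by simp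
    moreover have "g k z \<noteq> 0 \<longleftrightarrow> U k z \<noteq> 0" for z
      using U(3)[of k z] by (auto simp: g_def enn2real_eq_0_iff)
    ultimately show ?thesis by (simp add: top.not_eq_extremum)
  qed
  have step: "(\<integral>\<^sup>+\<omega>. (INF n. ?P (g k) n \<omega>) \<partial>M) = ennreal (exp (- (\<integral>z. g k z \<partial>\<mu>)))" for k
    by (rule poisson_process_product_simple[OF M pp g_simple g(1,3) fin])
  have "(INF n. ?P f n \<omega>) = (INF k. INF n. ?P (g k) n \<omega>)" for \<omega>
  proof -
    have "(INF k. ?P (g k) n \<omega>) = ?P f n \<omega>" for n
    proof (rule LIMSEQ_unique[OF LIMSEQ_INF])
      show "decseq (\<lambda>k. ?P (g k) n \<omega>)"
        using g g_incr by (intro decseq_SucI ennreal_leI prod_mono) (auto intro: diff_left_mono)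
      show "(\<lambda>k. ?P (g k) n \<omega>) \<longlonglongrightarrow> ?P f n \<omega>"
        by (intro tendsto_ennrealI tendsto_prod tendsto_diff tendsto_const g_lim)
    qed
    then show ?thesis by (subst INF_commute) simp
  qed
  then have "(\<integral>\<^sup>+\<omega>. (INF n. ?P f n \<omega>) \<partial>M) = (\<integral>\<^sup>+\<omega>. (INF k. INF n. ?P (g k) n \<omega>) \<partial>M)"
    by simp
  also have "\<dots> = (INF k. \<integral>\<^sup>+\<omega>. (INF n. ?P (g k) n \<omega>) \<partial>M)"
  proof (rule nn_integral_monotone_convergence_INF_decseq)
    show "decseq (\<lambda>k \<omega>. INF n. ?P (g k) n \<omega>)"
      using g g_incr by (intro decseq_SucI le_funI INF_mono' ennreal_leI prod_mono)
        (auto intro: diff_left_mono)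
  qed (auto simp: step)
  also have "\<dots> = (INF k. ennreal (exp (- (\<integral>z. g k z \<partial>\<mu>))))"
    by (simp add: step)
  also have "\<dots> = ennreal (exp (- (\<integral>z. f z \<partial>\<mu>)))"
  proof (rule LIMSEQ_unique[OF LIMSEQ_INF])
    show "decseq (\<lambda>k. ennreal (exp (- (\<integral>z. g k z \<partial>\<mu>))))"
      using g_incr by (intro decseq_SucI ennreal_leI)
        (auto intro!: integral_mono int_g)
    have "(\<lambda>k. \<integral>z. g k z \<partial>\<mu>) \<longlonglongrightarrow> (\<integral>z. f z \<partial>\<mu>)"
      by (rule integral_dominated_convergence[where w=f]) (use f g g_lim in auto)
    then show "(\<lambda>k. ennreal (exp (- (\<integral>z. g k z \<partial>\<mu>)))) \<longlonglongrightarrow> ennreal (exp (- (\<integral>z. f z \<partial>\<mu>)))"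
      by (intro tendsto_ennrealI tendsto_exp tendsto_minus)
  qed
  finally show ?thesis .
qed

section \<open>Poisson processes with independent marks\<close>

text \<open>
  \<open>N\<close> has a double role: its \<open>\<sigma>\<close>-algebra makes the marks measurable, and its measure is their
  common law.
\<close>

locale marked_poisson = prob_space M + points: sigma_finite_measure \<mu> + marks: prob_space N
  for M :: "'w measure" and \<mu> :: "'a measure" and N :: "'b measure" +
  fixes Z :: "nat \<Rightarrow> 'w \<Rightarrow> 'a" and L :: "nat \<Rightarrow> 'w \<Rightarrow> 'b"
  assumes poisson: "poisson_process M \<mu> Z"
    and marks_measurable: "\<And>i. L i \<in> measurable M N"
    and marks_distr: "\<And>i. distr M N (L i) = N"
    and marks_indep: "indep_vars (\<lambda>_. N) L UNIV"
    and points_marks_indep: "indep_set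
       {(\<lambda>\<omega> i. Z i \<omega>) -` A \<inter> space M |A. A \<in> sets (\<Pi>\<^sub>M i\<in>UNIV. \<mu>)}
       {(\<lambda>\<omega> i. L i \<omega>) -` B \<inter> space M |B. B \<in> sets (\<Pi>\<^sub>M i\<in>UNIV. N)}"
begin

lemma points_measurable [measurable]: "Z i \<in> measurable M \<mu>"
  using poisson unfolding poisson_process_def by blast

declare marks_measurable [measurable]

lemma marked_point_measurable [measurable]: "(\<lambda>\<omega>. (Z i \<omega>, L i \<omega>)) \<in> measurable M (\<mu> \<Otimes>\<^sub>M N)"
  by measurable

definition void :: "('a \<times> 'b) set \<Rightarrow> 'w set" where
  "void A = {\<omega> \<in> space M. \<forall>i. (Z i \<omega>, L i \<omega>) \<notin> A}"

lemma void_measurable [measurable]: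
  assumes [measurable]: "A \<in> sets (\<mu> \<Otimes>\<^sub>M N)"
  shows "void A \<in> sets M"
  unfolding void_def by measurable

text \<open>
  Independence of the points and the marks, as a statement about laws: it lets expectations be
  computed by integrating over the marks first, with the points held fixed.
\<close>

lemma joint_distr:
  "distr M ((\<Pi>\<^sub>M i\<in>UNIV. \<mu>) \<Otimes>\<^sub>M (\<Pi>\<^sub>M i\<in>UNIV. N)) (\<lambda>\<omega>. (\<lambda>i. Z i \<omega>, \<lambda>i. L i \<omega>)) =
   distr M (\<Pi>\<^sub>M i\<in>UNIV. \<mu>) (\<lambda>\<omega> i. Z i \<omega>) \<Otimes>\<^sub>M (\<Pi>\<^sub>M i\<in>UNIV. N)"
  (is "distr M (?PZ \<Otimes>\<^sub>M ?PN) ?J = ?DZ \<Otimes>\<^sub>M ?PN")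
proof -
  interpret PN: prob_space ?PN by (intro prob_space_PiM marks.prob_space_axioms)
  have ms[measurable]: "(\<lambda>\<omega> i. Z i \<omega>) \<in> measurable M ?PZ" "(\<lambda>\<omega> i. L i \<omega>) \<in> measurable M ?PN"
    by (rule measurable_PiM_single'; auto simp: space_PiM PiE_def intro: measurable_space[OF points_measurable] measurable_space[OF marks_measurable])+
  interpret DZ: prob_space ?DZ by (intro prob_space_distr ms)
  have "distr M ?PN (\<lambda>\<omega> i. L i \<omega>) = ?PN"
    using indep_vars_iff_distr_eq_PiM[THEN iffD1, OF _ marks_measurable marks_indep]
    by (simp add: marks_distr restrict_UNIV)
  then have PN: "emeasure ?PN B = emeasure M ((\<lambda>\<omega> i. L i \<omega>) -` B \<inter> space M)" if "B \<in> sets ?PN" for B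
    using emeasure_distr[OF ms(2) that] by simp
  show ?thesis
  proof (rule pair_measure_eqI[symmetric])
    fix A B assume "A \<in> sets ?DZ" and B: "B \<in> sets ?PN"
    then have A: "A \<in> sets ?PZ" by simp
    have "emeasure (distr M (?PZ \<Otimes>\<^sub>M ?PN) ?J) (A \<times> B) =
        emeasure M (((\<lambda>\<omega> i. Z i \<omega>) -` A \<inter> space M) \<inter> ((\<lambda>\<omega> i. L i \<omega>) -` B \<inter> space M))"
      using A B by (subst emeasure_distr) (auto intro!: arg_cong[where f="emeasure M"])
    also have "\<dots> = emeasure M ((\<lambda>\<omega> i. Z i \<omega>) -` A \<inter> space M) * emeasure M ((\<lambda>\<omega> i. L i \<omega>) -` B \<inter> space M)"
      using indep_setD[OF points_marks_indep] A B
      by (simp add: emeasure_eq_measure ennreal_mult[symmetric]) blast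
    also have "\<dots> = emeasure ?DZ A * emeasure ?PN B"
      using A B by (simp add: PN emeasure_distr)
    finally show "emeasure ?DZ A * emeasure ?PN B = emeasure (distr M (?PZ \<Otimes>\<^sub>M ?PN) ?J) (A \<times> B)" ..
  qed (simp_all add: PN.sigma_finite_measure_axioms DZ.sigma_finite_measure_axioms cong: sets_pair_measure_cong)
qed

lemma finite_void_probability:
  assumes A[measurable]: "A \<in> sets (\<mu> \<Otimes>\<^sub>M N)"
  shows "emeasure M {\<omega> \<in> space M. \<forall>i<n. (Z i \<omega>, L i \<omega>) \<notin> A} =
    (\<integral>\<^sup>+\<omega>. ennreal (\<Prod>i<n. 1 - measure N (Pair (Z i \<omega>) -` A)) \<partial>M)"
proof -
  let ?PZ = "\<Pi>\<^sub>M i\<in>(UNIV::nat set). \<mu>" and ?PN = "\<Pi>\<^sub>M i\<in>(UNIV::nat set). N"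
  interpret PN: prob_space ?PN by (intro prob_space_PiM marks.prob_space_axioms)
  have [measurable]: "(\<lambda>\<omega> i. Z i \<omega>) \<in> measurable M ?PZ" "(\<lambda>\<omega> i. L i \<omega>) \<in> measurable M ?PN"
    by (rule measurable_PiM_single'; auto simp: space_PiM PiE_def intro: measurable_space[OF points_measurable] measurable_space[OF marks_measurable])+
  define B where "B = {x \<in> space (?PZ \<Otimes>\<^sub>M ?PN). \<forall>i<n. (fst x i, snd x i) \<notin> A}"
  have [measurable]: "(\<lambda>x. (fst x i, snd x i)) \<in> measurable (?PZ \<Otimes>\<^sub>M ?PN) (\<mu> \<Otimes>\<^sub>M N)" for i
    by (intro measurable_Pair measurable_compose[OF measurable_fst] measurable_compose[OF measurable_snd]
      measurable_component_singleton) auto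
  have [measurable]: "B \<in> sets (?PZ \<Otimes>\<^sub>M ?PN)" unfolding B_def by measurable
  have sec: "emeasure ?PN (Pair z -` B) = ennreal (\<Prod>i<n. 1 - measure N (Pair (z i) -` A))"
    if z: "z \<in> space ?PZ" for z
  proof -
    have [measurable]: "Pair (z i) -` A \<in> sets N" for i
      by (rule sets_Pair1[OF A])
    have "Pair z -` B = prod_emb UNIV (\<lambda>_. N) {..<n} (Pi\<^sub>E {..<n} (\<lambda>i. space N - Pair (z i) -` A))"
      using z by (auto simp: B_def prod_emb_def space_pair_measure space_PiM PiE_def Pi_def extensional_def restrict_def)
    then have "emeasure ?PN (Pair z -` B) = (\<Prod>i<n. emeasure N (space N - Pair (z i) -` A))"
      by (simp add: emeasure_PiM_emb marks.prob_space_axioms)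
    also have "\<dots> = (\<Prod>i<n. ennreal (1 - measure N (Pair (z i) -` A)))"
      by (intro prod.cong) (auto simp: marks.emeasure_eq_measure marks.prob_compl)
    also have "\<dots> = ennreal (\<Prod>i<n. 1 - measure N (Pair (z i) -` A))"
      by (intro prod_ennreal) (auto)
    finally show ?thesis .
  qed
  have [measurable]: "(\<lambda>z. measure N (Pair z -` A)) \<in> borel_measurable \<mu>"
    unfolding measure_def using marks.measurable_emeasure_Pair[OF A] by simp
  have "{\<omega> \<in> space M. \<forall>i<n. (Z i \<omega>, L i \<omega>) \<notin> A} =
      (\<lambda>\<omega>. (\<lambda>i. Z i \<omega>, \<lambda>i. L i \<omega>)) -` B \<inter> space M"
    by (auto simp: B_def space_pair_measure space_PiM PiE_def
      intro: measurable_space[OF points_measurable] measurable_space[OF marks_measurable])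
  then have "emeasure M {\<omega> \<in> space M. \<forall>i<n. (Z i \<omega>, L i \<omega>) \<notin> A} =
      emeasure (distr M (?PZ \<Otimes>\<^sub>M ?PN) (\<lambda>\<omega>. (\<lambda>i. Z i \<omega>, \<lambda>i. L i \<omega>))) B"
    by (subst emeasure_distr) auto
  also have "\<dots> = (\<integral>\<^sup>+z. emeasure ?PN (Pair z -` B) \<partial>distr M ?PZ (\<lambda>\<omega> i. Z i \<omega>))"
    unfolding joint_distr by (rule PN.emeasure_pair_measure_alt) simp
  also have "\<dots> = (\<integral>\<^sup>+z. ennreal (\<Prod>i<n. 1 - measure N (Pair (z i) -` A)) \<partial>distr M ?PZ (\<lambda>\<omega> i. Z i \<omega>))"
    by (intro nn_integral_cong sec) simp
  also have "\<dots> = (\<integral>\<^sup>+\<omega>. ennreal (\<Prod>i<n. 1 - measure N (Pair (Z i \<omega>) -` A)) \<partial>M)"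
    by (subst nn_integral_distr) auto
  finally show ?thesis .
qed

text \<open>
  With the points fixed, the marks avoid \<open>A\<close> independently, each with probability
  \<open>1 - measure N (Pair z -` A)\<close> at a point \<open>z\<close>. What remains is a product functional of the
  unmarked process.
\<close>

lemma void_probability:
  assumes A[measurable]: "A \<in> sets (\<mu> \<Otimes>\<^sub>M N)" and fin: "emeasure (\<mu> \<Otimes>\<^sub>M N) A < \<infinity>"
  shows "prob (void A) = exp (- measure (\<mu> \<Otimes>\<^sub>M N) A)"
proof -
  define p where "p z = measure N (Pair z -` A)" for z
  have [measurable]: "p \<in> borel_measurable \<mu>"
    unfolding p_def measure_def using marks.measurable_emeasure_Pair[OF A] by simp
  have p: "0 \<le> p z" "p z \<le> 1" for z by (auto simp: p_def)
  have mA: "(\<integral>\<^sup>+z. ennreal (p z) \<partial>\<mu>) = emeasure (\<mu> \<Otimes>\<^sub>M N) A"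
    by (simp add: p_def marks.emeasure_eq_measure[symmetric] marks.emeasure_pair_measure_alt)
  then have int: "integrable \<mu> p"
    using fin p by (intro integrableI_nonneg) auto
  have "ennreal (\<integral>z. p z \<partial>\<mu>) = emeasure (\<mu> \<Otimes>\<^sub>M N) A"
    using mA nn_integral_eq_integral[OF int] p by simp
  then have int_p: "(\<integral>z. p z \<partial>\<mu>) = measure (\<mu> \<Otimes>\<^sub>M N) A"
    using p by (metis Bochner_Integration.integral_nonneg enn2real_ennreal measure_def)
  let ?V = "\<lambda>n. {\<omega> \<in> space M. \<forall>i<n. (Z i \<omega>, L i \<omega>) \<notin> A}"
  let ?P = "\<lambda>n \<omega>. ennreal (\<Prod>i<n. 1 - p (Z i \<omega>))"
  have "emeasure M (void A) = emeasure M (\<Inter>n. ?V n)"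
    by (rule arg_cong[where f="emeasure M"]) (auto simp: void_def)
  also have "\<dots> = (INF n. emeasure M (?V n))"
  proof (rule INF_emeasure_decseq[symmetric])
    show "decseq ?V" by (auto simp: decseq_def)
  qed auto
  also have "\<dots> = (INF n. \<integral>\<^sup>+\<omega>. ?P n \<omega> \<partial>M)"
    by (simp add: finite_void_probability[OF A] p_def)
  also have "\<dots> = (\<integral>\<^sup>+\<omega>. (INF n. ?P n \<omega>) \<partial>M)"
  proof (rule nn_integral_monotone_convergence_INF_decseq[symmetric, where i=0])
    show "decseq ?P"
      using decseq_prod_le_1[of "\<lambda>i. 1 - p (Z i \<omega>)" for \<omega>] p
      by (simp add: monotone_def le_fun_def)
  qed (auto simp: emeasure_space_1)
  also have "\<dots> = ennreal (exp (- measure (\<mu> \<Otimes>\<^sub>M N) A))"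
    using poisson_process_product[OF prob_space_axioms poisson int p] int_p by simp
  finally show ?thesis by (simp add: emeasure_eq_measure)
qed

text \<open>
  Let \<open>S k\<close> increase to the whole space with finite measures. The part of \<open>A\<close> outside \<open>S k\<close> has
  measure tending to \<open>0\<close>, so almost surely it is void for some \<open>k\<close>; inside \<open>S k\<close> there are only
  finitely many points, whatever their marks. In this way void probabilities replace the
  computation of an expected number of points.
\<close>

lemma finitely_many_marked_points:
  assumes A[measurable]: "A \<in> sets (\<mu> \<Otimes>\<^sub>M N)" and fin: "emeasure (\<mu> \<Otimes>\<^sub>M N) A < \<infinity>"
  shows "AE \<omega> in M. finite {i. (Z i \<omega>, L i \<omega>) \<in> A}"
proof -
  obtain S :: "nat \<Rightarrow> 'a set" where S: "range S \<subseteq> sets \<mu>" "(\<Union>k. S k) = space \<mu>"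
    "\<And>k. emeasure \<mu> (S k) \<noteq> \<infinity>" "incseq S"
    using points.sigma_finite_incseq by blast
  have [measurable]: "S k \<in> sets \<mu>" for k using S(1) by auto
  define R where "R k = A - S k \<times> space N" for k
  have [measurable]: "R k \<in> sets (\<mu> \<Otimes>\<^sub>M N)" for k unfolding R_def by measurable
  have R_fin: "emeasure (\<mu> \<Otimes>\<^sub>M N) (R k) < \<infinity>" for k
  proof -
    have "emeasure (\<mu> \<Otimes>\<^sub>M N) (R k) \<le> emeasure (\<mu> \<Otimes>\<^sub>M N) A"
      by (intro emeasure_mono) (auto simp: R_def)
    then show ?thesis using fin by (rule le_less_trans)
  qed
  have "(\<Inter>k. R k) = {}"
  proof -
    have "z \<notin> (\<Inter>k. R k)" for z
    proof
      assume z: "z \<in> (\<Inter>k. R k)"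
      then have "z \<in> space (\<mu> \<Otimes>\<^sub>M N)" using sets.sets_into_space[OF A] by (auto simp: R_def)
      then obtain k where "z \<in> S k \<times> space N"
        using S(2) by (cases z) (auto simp: space_pair_measure)
      then show False using z by (auto simp: R_def)
    qed
    then show ?thesis by auto
  qed
  then have "(\<lambda>k. measure (\<mu> \<Otimes>\<^sub>M N) (R k)) \<longlonglongrightarrow> 0"
  proof -
    have "decseq R" unfolding decseq_def R_def using S(4) by (blast dest: incseqD)
    moreover have "range R \<subseteq> sets (\<mu> \<Otimes>\<^sub>M N)" by auto
    moreover have "emeasure (\<mu> \<Otimes>\<^sub>M N) (R k) \<noteq> \<infinity>" for k using R_fin[of k] by simp
    ultimately show ?thesis using Lim_measure_decseq[of R "\<mu> \<Otimes>\<^sub>M N"] \<open>(\<Inter>k. R k) = {}\<close> by simp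
  qed
  then have "(\<lambda>k. exp (- measure (\<mu> \<Otimes>\<^sub>M N) (R k))) \<longlonglongrightarrow> exp (- 0)"
    by (intro tendsto_intros)
  then have lim: "(\<lambda>k. prob (void (R k))) \<longlonglongrightarrow> 1"
    by (simp add: void_probability[OF _ R_fin])
  have "prob (\<Union>k. void (R k)) = 1"
  proof (rule antisym)
    show "1 \<le> prob (\<Union>k. void (R k))"
      by (rule LIMSEQ_le_const2[OF lim]) (intro exI allI impI finite_measure_mono; auto)
  qed simp
  then have "AE \<omega> in M. \<omega> \<in> (\<Union>k. void (R k))"
    by (subst prob_eq_1[symmetric]) auto
  moreover have "AE \<omega> in M. \<forall>k. finite {i. Z i \<omega> \<in> S k}"
    unfolding AE_all_countable
    using poisson S by (auto simp: poisson_process_def top.not_eq_extremum)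
  ultimately show ?thesis
  proof eventually_elim
    fix \<omega> assume "\<omega> \<in> (\<Union>k. void (R k))" and fin: "\<forall>k. finite {i. Z i \<omega> \<in> S k}"
    then obtain k where "\<omega> \<in> void (R k)" by auto
    then have "{i. (Z i \<omega>, L i \<omega>) \<in> A} \<subseteq> {i. Z i \<omega> \<in> S k}"
      using measurable_space[OF marks_measurable] by (auto simp: void_def R_def)
    then show "finite {i. (Z i \<omega>, L i \<omega>) \<in> A}" using fin finite_subset by blast
  qed
qed

end

section \<open>Chains of most recent points\<close>

text \<open>
  Points have times \<open>T\<close> and two nested kinds \<open>G k \<subseteq> H k\<close>. A chain from \<open>s\<close> picks the most recent
  point of kind \<open>H k\<close> before \<open>s\<close>, requires it to be of kind \<open>G k\<close>, and goes on from its time with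
  \<open>k - 1\<close>. The level counts from \<open>0\<close>, so \<open>latest_chain T H G n\<close> uses the kinds with index below \<open>n\<close>.
\<close>

fun latest_chain :: "('i \<Rightarrow> real) \<Rightarrow> (nat \<Rightarrow> 'i set) \<Rightarrow> (nat \<Rightarrow> 'i set) \<Rightarrow> nat \<Rightarrow> real \<Rightarrow> bool" where
  "latest_chain T H G 0 s \<longleftrightarrow> True"
| "latest_chain T H G (Suc k) s \<longleftrightarrow>
    (\<exists>i\<in>G k. T i < s \<and> (\<forall>j\<in>H k. T j \<notin> {T i<..<s}) \<and> latest_chain T H G k (T i))"

text \<open>
  The discretised chain. Slot \<open>m\<close> is the time interval from \<open>- (m + 1) * d\<close> up to \<open>- m * d\<close>, and
  \<open>r\<close> is the number of slots skipped because they have no point of kind \<open>H k\<close>. Several points of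
  kind \<open>G k\<close> are allowed in the chosen slot, so that each condition says that certain sets are void,
  or not.
\<close>

fun slotted_chain :: "('i \<Rightarrow> real) \<Rightarrow> (nat \<Rightarrow> 'i set) \<Rightarrow> (nat \<Rightarrow> 'i set) \<Rightarrow> real \<Rightarrow> nat \<Rightarrow> nat \<Rightarrow> bool" where
  "slotted_chain T H G d 0 m \<longleftrightarrow> True"
| "slotted_chain T H G d (Suc k) m \<longleftrightarrow>
    (\<exists>r. (\<forall>j\<in>H k. T j \<notin> {- real (m + r) * d ..< - real m * d}) \<and>
         (\<forall>j\<in>H k - G k. T j \<notin> {- real (m + r + 1) * d ..< - real (m + r) * d}) \<and>
         (\<exists>j\<in>H k. T j \<in> {- real (m + r + 1) * d ..< - real (m + r) * d}) \<and>
         slotted_chain T H G d k (m + r + 1))"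

lemma latest_chain_extend:
  assumes "latest_chain T H G k s" "s \<le> s'"
    and "\<And>k' j. k = Suc k' \<Longrightarrow> j \<in> H k' \<Longrightarrow> T j \<notin> {s..<s'}"
  shows "latest_chain T H G k s'"
proof (cases k)
  case (Suc k')
  with assms(1) obtain i where "i \<in> G k'" "T i < s" "\<forall>j\<in>H k'. T j \<notin> {T i<..<s}"
    "latest_chain T H G k' (T i)" by auto
  moreover have "\<forall>j\<in>H k'. T j \<notin> {T i<..<s'}"
    using calculation(3) assms(3)[OF Suc] by fastforce
  ultimately show ?thesis using assms(2) Suc by (auto intro!: bexI[of _ i])
qed simp

text \<open>
  In the chosen slot all points of kind \<open>H k\<close> are of kind \<open>G k\<close>, and the latest of them continues the
  chain. The rest of that slot does no harm at the next level, since points of kind \<open>G k\<close> are not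
  of kind \<open>H (k - 1)\<close>.
\<close>

lemma slotted_chain_imp_latest_chain:
  assumes d: "0 < d"
    and fin: "\<And>k a. k < n \<Longrightarrow> finite {j \<in> H k. T j \<in> {a..<0}}"
    and GH: "\<And>k. Suc k < n \<Longrightarrow> G (Suc k) \<inter> H k = {}"
    and mono: "\<And>k. Suc k < n \<Longrightarrow> H k \<subseteq> H (Suc k)"
  shows "k \<le> n \<Longrightarrow> slotted_chain T H G d k m \<Longrightarrow> latest_chain T H G k (- real m * d)"
proof (induction k arbitrary: m)
  case (Suc k)
  define c where "c = - real m * d"
  define b where "b r = - real (m + r) * d" for r
  define a where "a r = - real (m + r + 1) * d" for r
  obtain r where r: "\<forall>j\<in>H k. T j \<notin> {b r ..< c}" "\<forall>j\<in>H k - G k. T j \<notin> {a r ..< b r}"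
    "\<exists>j\<in>H k. T j \<in> {a r ..< b r}" "slotted_chain T H G d k (m + r + 1)"
    using Suc.prems(2) unfolding slotted_chain.simps a_def b_def c_def by blast
  have ord: "a r < b r" "b r \<le> c" "c \<le> 0" using d by (auto simp: a_def b_def c_def algebra_simps)
  define J where "J = {j \<in> H k. T j \<in> {a r ..< b r}}"
  have "J \<subseteq> {j \<in> H k. T j \<in> {a r..<0}}" using ord by (auto simp: J_def)
  then have "finite J" using fin[of k] Suc.prems(1) by (auto intro: finite_subset)
  moreover have "J \<noteq> {}" using r(3) by (auto simp: J_def)
  ultimately have "Max (T ` J) \<in> T ` J" by (intro Max_in) auto
  then obtain i where i: "i \<in> J" "T i = Max (T ` J)" by auto
  have i_max: "T j \<le> T i" if "j \<in> J" for j
    using that i(2) \<open>finite J\<close> by auto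
  have iG: "i \<in> G k" "i \<in> H k" "a r \<le> T i" "T i < b r" using i(1) r(2) by (auto simp: J_def)
  have J_G: "J \<subseteq> G k" using r(2) by (auto simp: J_def)
  have "latest_chain T H G k (a r)"
    using Suc.IH[OF _ r(4)] Suc.prems(1) by (simp add: a_def)
  then have "latest_chain T H G k (T i)"
  proof (rule latest_chain_extend)
    fix k' j assume k: "k = Suc k'" and j: "j \<in> H k'"
    have "j \<in> H k" "j \<notin> G k" using j mono[of k'] GH[of k'] k Suc.prems(1) by auto
    then show "T j \<notin> {a r..<T i}" using r(2) iG(4) by auto
  qed (use iG in simp)
  moreover have "\<forall>j\<in>H k. T j \<notin> {T i<..<c}"
  proof
    fix j assume j: "j \<in> H k"
    show "T j \<notin> {T i<..<c}"
    proof
      assume T: "T j \<in> {T i<..<c}"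
      then have "T j < b r" using r(1) j by fastforce
      then have "j \<in> J" using T iG j by (auto simp: J_def)
      then show False using i_max T by fastforce
    qed
  qed
  ultimately show ?case
    using iG ord unfolding latest_chain.simps c_def[symmetric] by (intro bexI[of _ i]) auto
qed simp

text \<open>
  Times are distinct and locally finite, so a slot that is short enough and contains the chosen
  point contains no point of kind \<open>H k\<close> of an earlier time. The conclusion is uniform in \<open>m\<close>
  because after the first step the starting slot depends on \<open>d\<close>: all that is known is that slot
  \<open>m - 1\<close> contains \<open>s\<close>.
\<close>

lemma latest_chain_imp_slotted_chain:
  assumes fin: "\<And>k a. k < n \<Longrightarrow> finite {j \<in> H k. T j \<in> {a..<0}}"
    and inj: "inj T"
    and sub: "\<And>k. k < n \<Longrightarrow> G k \<subseteq> H k"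
  shows "k \<le> n \<Longrightarrow> s \<le> 0 \<Longrightarrow> latest_chain T H G k s \<Longrightarrow>
    \<exists>e>0. \<forall>d m. 0 < d \<longrightarrow> d < e \<longrightarrow> - real m * d \<le> s \<longrightarrow> s < - real m * d + d \<longrightarrow> slotted_chain T H G d k m"
proof (induction k arbitrary: s)
  case (Suc k)
  obtain i where i: "i \<in> G k" "T i < s" "\<forall>j\<in>H k. T j \<notin> {T i<..<s}" "latest_chain T H G k (T i)"
    using Suc.prems(3) by auto
  have iH: "i \<in> H k" using sub[of k] i(1) Suc.prems(1) by auto
  obtain e1 where e1: "e1 > 0" "\<And>d m. \<lbrakk>0 < d; d < e1; - real m * d \<le> T i; T i < - real m * d + d\<rbrakk>
      \<Longrightarrow> slotted_chain T H G d k m"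
    using Suc.IH[OF _ _ i(4)] Suc.prems i(2) by auto
  define J where "J = T ` {j \<in> H k. T j \<in> {T i - 1..<0}} - {T i}"
  have "finite J" unfolding J_def using fin[of k] Suc.prems(1) by auto
  then obtain e2 where e2: "e2 > 0" "\<forall>y\<in>J. y \<noteq> T i \<longrightarrow> e2 \<le> dist (T i) y"
    using finite_set_avoid by metis
  define e where "e = Min {e1, e2, 1, s - T i}"
  have e: "e > 0" "e \<le> e1" "e \<le> e2" "e \<le> 1" "e \<le> s - T i" using e1 e2 i(2) by (auto simp: e_def)
  show ?case
  proof (intro exI[of _ e] conjI allI impI e)
    fix d m assume d: "0 < d" "d < e" and m: "- real m * d \<le> s" "s < - real m * d + d"
    \<comment> \<open>The number of the slot that contains \<open>T i\<close>; slots are closed below and open above, hence the ceiling.\<close>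
    define q where "q = nat (\<lceil>- T i / d\<rceil> - 1)"
    have ceil: "of_int \<lceil>- T i / d\<rceil> - 1 < - T i / d" "- T i / d \<le> of_int \<lceil>- T i / d\<rceil>" by linarith+
    have "T i < - real m * d" using d e m by linarith
    then have "real m < - T i / d" using d by (simp add: field_simps)
    then have "int m \<le> \<lceil>- T i / d\<rceil> - 1" by linarith
    then have q: "m \<le> q" "real q = of_int \<lceil>- T i / d\<rceil> - 1" unfolding q_def by linarith+
    define r where "r = q - m"
    have mr: "m + r = q" using q(1) by (simp add: r_def)
    have slot: "- real (q + 1) * d \<le> T i" "T i < - real q * d"
    proof -
      have "- T i / d \<le> real (q + 1)" "real q < - T i / d" using ceil q(2) by auto
      then have "- T i \<le> real (q + 1) * d" "real q * d < - T i"
        unfolding pos_divide_le_eq[OF d(1)] pos_less_divide_eq[OF d(1)] .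
      then show "- real (q + 1) * d \<le> T i" "T i < - real q * d"
        unfolding mult_minus_left by linarith+
    qed
    show "slotted_chain T H G d (Suc k) m"
      unfolding slotted_chain.simps mr
    proof (intro exI[of _ r] conjI ballI, unfold mr)
      fix j assume j: "j \<in> H k"
      show "T j \<notin> {- real q * d ..< - real m * d}"
        using i(3) j slot m by fastforce
    next
      fix j assume j: "j \<in> H k - G k"
      then have ne: "T j \<noteq> T i" using i(1) inj by (auto dest: injD)
      show "T j \<notin> {- real (q + 1) * d ..< - real q * d}"
      proof
        assume T: "T j \<in> {- real (q + 1) * d ..< - real q * d}"
        have "- real q * d \<le> - real m * d" using q(1) d by (intro mult_right_mono) auto
        moreover have "T j < - real q * d" using T unfolding atLeastLessThan_iff by blast
        ultimately have "T j < s" "T j < 0" using m Suc.prems(2) by linarith+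
        then have "T j < T i" using i(3) j ne by fastforce
        moreover have "T i - T j < d" using T slot by (simp add: algebra_simps)
        ultimately have "T j \<in> J" "dist (T i) (T j) < e2"
          using e d j \<open>T j < 0\<close> by (auto simp: J_def dist_real_def)
        then show False using e2(2) ne by force
      qed
    next
      show "\<exists>j\<in>H k. T j \<in> {- real (q + 1) * d ..< - real q * d}"
        using iH slot by auto
      show "slotted_chain T H G d k (q + 1)"
        using slot d e by (intro e1) (auto simp: algebra_simps)
    qed
  qed
qed (auto intro: exI[of _ 1])

text \<open>
  Unfolds the recursion and replaces the horizon \<open>T p\<close> of each step by the original \<open>s\<close>. Beyond \<open>T p\<close>
  a point of kind \<open>H j\<close> would be of kind \<open>H k\<close> as well, which is excluded up to \<open>s\<close>; at \<open>T p\<close>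
  itself the only point is \<open>p\<close>, which is of kind \<open>G k\<close> and therefore not of kind \<open>H j\<close>.
\<close>

lemma latest_chain_witnesses:
  assumes inj: "inj T"
    and GH: "\<And>k. Suc k < n \<Longrightarrow> G (Suc k) \<inter> H k = {}"
    and mono: "\<And>j k. j \<le> k \<Longrightarrow> k < n \<Longrightarrow> H j \<subseteq> H k"
  shows "k \<le> n \<Longrightarrow> latest_chain T H G k s \<Longrightarrow>
    \<exists>i. (\<forall>j<k. i j \<in> G j \<and> T (i j) < s \<and> (\<forall>l\<in>H j. T l \<notin> {T (i j)<..<s})) \<and>
      (\<forall>j j'. j < j' \<longrightarrow> j' < k \<longrightarrow> T (i j) < T (i j'))"
proof (induction k arbitrary: s)
  case (Suc k)
  obtain p where p: "p \<in> G k" "T p < s" "\<forall>l\<in>H k. T l \<notin> {T p<..<s}" "latest_chain T H G k (T p)"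
    using Suc.prems(2) by auto
  obtain i where i: "\<And>j. j < k \<Longrightarrow> i j \<in> G j \<and> T (i j) < T p \<and> (\<forall>l\<in>H j. T l \<notin> {T (i j)<..<T p})"
    "\<And>j j'. j < j' \<Longrightarrow> j' < k \<Longrightarrow> T (i j) < T (i j')"
    using Suc.IH[OF _ p(4)] Suc.prems(1) by auto
  define i' where "i' = i(k := p)"
  have "i' j \<in> G j \<and> T (i' j) < s \<and> (\<forall>l\<in>H j. T l \<notin> {T (i' j)<..<s})" if "j < Suc k" for j
  proof (cases "j = k")
    case True
    then show ?thesis using p by (simp add: i'_def)
  next
    case False
    then have j: "j < k" "i' j = i j" using that by (auto simp: i'_def)
    have "T l \<notin> {T (i j)<..<s}" if l: "l \<in> H j" for l
    proof -
      have "p \<notin> H j"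
      proof -
        obtain k' where k': "k = Suc k'" using j(1) by (cases k) auto
        then have "H j \<subseteq> H k'" using j(1) Suc.prems(1) by (intro mono) auto
        then show ?thesis using GH[of k'] p(1) k' Suc.prems(1) by auto
      qed
      then have "T l \<noteq> T p" using l inj by (auto dest: injD)
      moreover have "l \<in> H k" using mono[of j k] j(1) Suc.prems(1) l by auto
      then have "\<not> (T p < T l \<and> T l < s)" using p(3) by auto
      moreover have "\<not> (T (i j) < T l \<and> T l < T p)" using i(1)[OF j(1)] l by auto
      ultimately show ?thesis by auto
    qed
    then show ?thesis using i(1)[OF j(1)] p(2) j(2) by auto
  qed
  moreover have "T (i' j) < T (i' j')" if "j < j'" "j' < Suc k" for j j'
    using that i by (cases "j' = k") (auto simp: i'_def)
  ultimately show ?case by blast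
qed simp

section \<open>The probability of a chain of most recent points\<close>

locale marked_poisson_in_time =
  marked_poisson M "\<kappa> \<Otimes>\<^sub>M (lborel :: real measure)" N Z L + locations: sigma_finite_measure \<kappa>
  for M :: "'w measure" and \<kappa> :: "'a measure" and N :: "'b measure"
    and Z :: "nat \<Rightarrow> 'w \<Rightarrow> 'a \<times> real" and L :: "nat \<Rightarrow> 'w \<Rightarrow> 'b"
begin

definition during :: "real set \<Rightarrow> ('a \<times> 'b) set \<Rightarrow> (('a \<times> real) \<times> 'b) set" where
  "during S H = {z. snd (fst z) \<in> S \<and> (fst (fst z), snd z) \<in> H}"

lemma during_measurable [measurable]:
  assumes [measurable]: "S \<in> sets borel" "H \<in> sets (\<kappa> \<Otimes>\<^sub>M N)"
  shows "during S H \<in> sets ((\<kappa> \<Otimes>\<^sub>M lborel) \<Otimes>\<^sub>M N)"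
proof -
  have "during S H = {z \<in> space ((\<kappa> \<Otimes>\<^sub>M lborel) \<Otimes>\<^sub>M N). snd (fst z) \<in> S \<and> (fst (fst z), snd z) \<in> H}"
    using sets.sets_into_space[OF assms(2)] by (auto simp: during_def space_pair_measure)
  also have "\<dots> \<in> sets ((\<kappa> \<Otimes>\<^sub>M lborel) \<Otimes>\<^sub>M N)" by measurable
  finally show ?thesis .
qed

lemma emeasure_during:
  assumes [measurable]: "S \<in> sets borel" "H \<in> sets (\<kappa> \<Otimes>\<^sub>M N)"
  shows "emeasure ((\<kappa> \<Otimes>\<^sub>M lborel) \<Otimes>\<^sub>M N) (during S H) = emeasure lborel S * emeasure (\<kappa> \<Otimes>\<^sub>M N) H"
proof -
  have [measurable]: "(\<lambda>x. emeasure N (Pair x -` H)) \<in> borel_measurable \<kappa>"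
    using marks.measurable_emeasure_Pair[OF assms(2)] .
  have "Pair z -` during S H = (if snd z \<in> S then Pair (fst z) -` H else {})" for z
    by (auto simp: during_def)
  then have "emeasure ((\<kappa> \<Otimes>\<^sub>M lborel) \<Otimes>\<^sub>M N) (during S H) =
      (\<integral>\<^sup>+z. emeasure N (Pair (fst z) -` H) * indicator S (snd z) \<partial>(\<kappa> \<Otimes>\<^sub>M lborel))"
    by (subst marks.emeasure_pair_measure_alt[OF during_measurable[OF assms]])
      (auto intro!: nn_integral_cong simp: indicator_def)
  also have "\<dots> = (\<integral>\<^sup>+x. \<integral>\<^sup>+t. emeasure N (Pair x -` H) * indicator S t \<partial>lborel \<partial>\<kappa>)"
    by (subst lborel.nn_integral_fst[symmetric]) auto
  also have "\<dots> = (\<integral>\<^sup>+x. emeasure N (Pair x -` H) * emeasure lborel S \<partial>\<kappa>)"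
    by (intro nn_integral_cong) (simp add: nn_integral_cmult_indicator)
  also have "\<dots> = emeasure lborel S * emeasure (\<kappa> \<Otimes>\<^sub>M N) H"
    by (subst nn_integral_multc) (auto simp: marks.emeasure_pair_measure_alt mult.commute)
  finally show ?thesis .
qed

definition time :: "'w \<Rightarrow> nat \<Rightarrow> real" where
  "time \<omega> i = snd (Z i \<omega>)"

definition of_kind :: "(nat \<Rightarrow> ('a \<times> 'b) set) \<Rightarrow> 'w \<Rightarrow> nat \<Rightarrow> nat set" where
  "of_kind H \<omega> k = {i. (fst (Z i \<omega>), L i \<omega>) \<in> H k}"

definition slotted_event :: "(nat \<Rightarrow> ('a \<times> 'b) set) \<Rightarrow> (nat \<Rightarrow> ('a \<times> 'b) set) \<Rightarrow> real \<Rightarrow> nat \<Rightarrow> nat \<Rightarrow> 'w set" where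
  "slotted_event H G d k m = {\<omega> \<in> space M. slotted_chain (time \<omega>) (of_kind H \<omega>) (of_kind G \<omega>) d k m}"

text \<open>
  \<open>A r\<close> must be void because the slots before are skipped, \<open>B r\<close> because the chosen slot has no bad
  point, and \<open>C r\<close> must not be void because the slot is not skipped.
\<close>

lemma slotted_event_Suc:
  fixes d m H k G
  defines "A \<equiv> \<lambda>r. during {- real (m + r) * d ..< - real m * d} (H k)"
    and "B \<equiv> \<lambda>r. during {- real (m + r + 1) * d ..< - real (m + r) * d} (H k - G k)"
    and "C \<equiv> \<lambda>r. during {- real (m + r + 1) * d ..< - real (m + r) * d} (H k)"
  shows "slotted_event H G d (Suc k) m =
    (\<Union>r. void (A r \<union> B r) \<inter> slotted_event H G d k (m + r + 1) - void (A r \<union> B r \<union> C r))"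
  by (fastforce simp: slotted_event_def A_def B_def C_def void_def during_def time_def of_kind_def)

lemma slotted_event_measurable:
  assumes "\<And>j. j < k \<Longrightarrow> H j \<in> sets (\<kappa> \<Otimes>\<^sub>M N)" "\<And>j. j < k \<Longrightarrow> G j \<in> sets (\<kappa> \<Otimes>\<^sub>M N)"
  shows "slotted_event H G d k m \<in> sets M"
  using assms
proof (induction k arbitrary: m)
  case 0
  show ?case by (simp add: slotted_event_def)
next
  case (Suc k)
  have [measurable]: "H k \<in> sets (\<kappa> \<Otimes>\<^sub>M N)" "G k \<in> sets (\<kappa> \<Otimes>\<^sub>M N)" using Suc.prems by auto
  have [measurable]: "slotted_event H G d k m \<in> sets M" for m
    using Suc.prems by (intro Suc.IH) auto
  show ?case unfolding slotted_event_Suc by measurable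
qed

text \<open>
  Induction over the levels of the chain. The extra void set \<open>B\<close>, located in the slots already
  visited, carries along everything known about them: after one step it absorbs the skipped and the
  chosen slots. Summation over the number of skipped slots is a geometric series with ratio
  \<open>exp (- d * |H k|)\<close>.
\<close>

lemma slotted_event_probability:
  assumes d: "0 < d"
    and H: "\<And>j. j < n \<Longrightarrow> H j \<in> sets (\<kappa> \<Otimes>\<^sub>M N)" "\<And>j. j < n \<Longrightarrow> emeasure (\<kappa> \<Otimes>\<^sub>M N) (H j) < \<infinity>"
      "\<And>j. j < n \<Longrightarrow> 0 < measure (\<kappa> \<Otimes>\<^sub>M N) (H j)"
    and G: "\<And>j. j < n \<Longrightarrow> G j \<in> sets (\<kappa> \<Otimes>\<^sub>M N)" "\<And>j. j < n \<Longrightarrow> G j \<subseteq> H j"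
    and k: "k \<le> n"
    and B: "B \<in> sets ((\<kappa> \<Otimes>\<^sub>M lborel) \<Otimes>\<^sub>M N)" "emeasure ((\<kappa> \<Otimes>\<^sub>M lborel) \<Otimes>\<^sub>M N) B < \<infinity>"
      "B \<subseteq> during {- real m * d ..} UNIV"
  shows "prob (void B \<inter> slotted_event H G d k m) = exp (- measure ((\<kappa> \<Otimes>\<^sub>M lborel) \<Otimes>\<^sub>M N) B) *
    (\<Prod>j<k. (exp (- d * measure (\<kappa> \<Otimes>\<^sub>M N) (H j - G j)) - exp (- d * measure (\<kappa> \<Otimes>\<^sub>M N) (H j))) /
      (1 - exp (- d * measure (\<kappa> \<Otimes>\<^sub>M N) (H j))))"
  using k B
proof (induction k arbitrary: m B)
  case 0
  then show ?case
    using sets.sets_into_space[OF void_measurable[OF 0(2)]]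
    by (simp add: slotted_event_def void_probability Int_absorb2)
next
  case (Suc k)
  let ?m = "(\<kappa> \<Otimes>\<^sub>M (lborel :: real measure)) \<Otimes>\<^sub>M N"
  define h where "h = measure (\<kappa> \<Otimes>\<^sub>M N) (H k)"
  define b where "b = measure (\<kappa> \<Otimes>\<^sub>M N) (H k - G k)"
  define c where "c = (\<Prod>j<k. (exp (- d * measure (\<kappa> \<Otimes>\<^sub>M N) (H j - G j)) - exp (- d * measure (\<kappa> \<Otimes>\<^sub>M N) (H j))) /
      (1 - exp (- d * measure (\<kappa> \<Otimes>\<^sub>M N) (H j))))"
  have kn: "k < n" using Suc.prems by simp
  note [measurable] = H(1)[OF kn] G(1)[OF kn] Suc.prems(2)
  have h_pos: "0 < h" using H(3)[OF kn] by (simp add: h_def)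
  have emH: "emeasure (\<kappa> \<Otimes>\<^sub>M N) (H k) = ennreal h"
    using H(2)[OF kn] by (simp add: h_def emeasure_eq_ennreal_measure)
  have "emeasure (\<kappa> \<Otimes>\<^sub>M N) (H k - G k) \<le> emeasure (\<kappa> \<Otimes>\<^sub>M N) (H k)" by (intro emeasure_mono) auto
  then have "emeasure (\<kappa> \<Otimes>\<^sub>M N) (H k - G k) < \<infinity>" using H(2)[OF kn] by (rule le_less_trans)
  then have emB: "emeasure (\<kappa> \<Otimes>\<^sub>M N) (H k - G k) = ennreal b"
    by (simp add: b_def emeasure_eq_ennreal_measure)
  have b0: "0 \<le> b" by (simp add: b_def)
  define A where "A r = during {- real (m + r) * d ..< - real m * d} (H k)" for r
  define D where "D r = during {- real (m + r + 1) * d ..< - real (m + r) * d} (H k - G k)" for r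
  define C where "C r = during {- real (m + r + 1) * d ..< - real (m + r) * d} (H k)" for r
  have [measurable]: "A r \<in> sets ?m" "D r \<in> sets ?m" "C r \<in> sets ?m" for r
    unfolding A_def C_def D_def by measurable
  have emA: "emeasure ?m (A r) = ennreal (real r * d * h)" for r
    using d h_pos by (simp add: A_def emeasure_during emH ennreal_mult[symmetric] algebra_simps)
  have emD: "emeasure ?m (D r) = ennreal (d * b)" for r
    using d b0 by (simp add: D_def emeasure_during emB ennreal_mult[symmetric] algebra_simps)
  have emC: "emeasure ?m (C r) = ennreal (d * h)" for r
    using d h_pos by (simp add: C_def emeasure_during emH ennreal_mult[symmetric] algebra_simps)
  have emBB: "emeasure ?m B = ennreal (measure ?m B)"
    using Suc.prems(3) by (simp add: emeasure_eq_ennreal_measure)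
  have DC: "D r \<subseteq> C r" for r by (auto simp: D_def C_def during_def)
  have neg: "- real (m + r + 1) * d \<le> - real (m + r) * d" "- real (m + r) * d \<le> - real m * d" for r
    using d by (auto simp: algebra_simps)
  have disj: "A r \<inter> C r = {}" "B \<inter> (A r \<union> C r) = {}" for r
    using Suc.prems(4) neg[of r] by (fastforce simp: A_def C_def during_def)+
  \<comment> \<open>\<open>V r\<close> is void if the first \<open>r\<close> slots are skipped and the next one has no bad point; \<open>W r\<close> is void if that slot is skipped as well.\<close>
  define V where "V r = B \<union> A r \<union> D r" for r
  define W where "W r = B \<union> A r \<union> C r" for r
  have [measurable]: "V r \<in> sets ?m" "W r \<in> sets ?m" for r unfolding V_def W_def by measurable
  have emV: "emeasure ?m (V r) = ennreal (measure ?m B + real r * d * h + d * b)" for r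
  proof -
    have "emeasure ?m (B \<union> A r) = emeasure ?m B + emeasure ?m (A r)"
      by (intro plus_emeasure[symmetric]) (measurable, use disj[of r] in blast)
    moreover have "emeasure ?m (V r) = emeasure ?m (B \<union> A r) + emeasure ?m (D r)"
      unfolding V_def by (intro plus_emeasure[symmetric]) (measurable, use disj[of r] DC[of r] in blast)
    ultimately show ?thesis using d h_pos b0 by (simp add: emBB emA emD ennreal_plus[symmetric] del: ennreal_plus)
  qed
  have emW: "emeasure ?m (W r) = ennreal (measure ?m B + real r * d * h + d * h)" for r
  proof -
    have "emeasure ?m (B \<union> A r) = emeasure ?m B + emeasure ?m (A r)"
      by (intro plus_emeasure[symmetric]) (measurable, use disj[of r] in blast)
    moreover have "emeasure ?m (W r) = emeasure ?m (B \<union> A r) + emeasure ?m (C r)"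
      unfolding W_def by (intro plus_emeasure[symmetric]) (measurable, use disj[of r] DC[of r] in blast)
    ultimately show ?thesis using d h_pos b0 by (simp add: emBB emA emC ennreal_plus[symmetric] del: ennreal_plus)
  qed
  have VW_sub: "V r \<subseteq> W r" "W r \<subseteq> during {- real (m + r + 1) * d ..} UNIV" for r
    using DC[of r] Suc.prems(4) neg[of r] by (fastforce simp: V_def W_def A_def C_def during_def)+
  have E_meas[measurable]: "slotted_event H G d k m' \<in> sets M" for m'
    using H(1) G(1) kn by (intro slotted_event_measurable) auto
  define Ev where "Ev r = (void (V r) \<inter> slotted_event H G d k (m + r + 1)) - (void (W r) \<inter> slotted_event H G d k (m + r + 1))" for r
  have [measurable]: "Ev r \<in> sets M" for r unfolding Ev_def by measurable
  have IH: "prob (void B' \<inter> slotted_event H G d k (m + r + 1)) = exp (- measure ?m B') * c"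
    if "B' \<in> sets ?m" "emeasure ?m B' < \<infinity>" "B' \<subseteq> W r" for B' r
    unfolding c_def using that VW_sub(2)[of r] kn by (intro Suc.IH) auto
  have "prob (Ev r) = exp (- measure ?m B) * c * (exp (- d * b) - exp (- d * h)) * exp (- d * h) ^ r" for r
  proof -
    have "prob (Ev r) = prob (void (V r) \<inter> slotted_event H G d k (m + r + 1)) -
        prob (void (W r) \<inter> slotted_event H G d k (m + r + 1))"
      unfolding Ev_def using VW_sub(1)[of r] by (intro finite_measure_Diff) (auto simp: void_def)
    also have "\<dots> = exp (- measure ?m (V r)) * c - exp (- measure ?m (W r)) * c"
    proof -
      have "prob (void (V r) \<inter> slotted_event H G d k (m + r + 1)) = exp (- measure ?m (V r)) * c"
        by (rule IH) (measurable, simp only: emV, simp, rule VW_sub)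
      moreover have "prob (void (W r) \<inter> slotted_event H G d k (m + r + 1)) = exp (- measure ?m (W r)) * c"
        by (rule IH) (measurable, simp only: emW, simp, simp)
      ultimately show ?thesis by simp
    qed
    also have "measure ?m (V r) = measure ?m B + real r * d * h + d * b"
      using emV[of r] d h_pos b0 by (simp add: measure_def del: ennreal_plus)
    also have "measure ?m (W r) = measure ?m B + real r * d * h + d * h"
      using emW[of r] d h_pos by (simp add: measure_def del: ennreal_plus)
    also have "exp (- (measure ?m B + real r * d * h + d * b)) =
        exp (- measure ?m B) * exp (- d * h) ^ r * exp (- d * b)"
      by (simp add: exp_of_nat_mult[symmetric] exp_add[symmetric] algebra_simps)
    also have "exp (- (measure ?m B + real r * d * h + d * h)) =
        exp (- measure ?m B) * exp (- d * h) ^ r * exp (- d * h)"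
      by (simp add: exp_of_nat_mult[symmetric] exp_add[symmetric] algebra_simps)
    finally show ?thesis
      by (simp add: algebra_simps)
  qed
  moreover have "(\<lambda>r. exp (- d * h) ^ r) sums (1 / (1 - exp (- d * h)))"
    using d h_pos by (intro geometric_sums) simp
  ultimately have "(\<lambda>r. prob (Ev r)) sums (exp (- measure ?m B) * c * (exp (- d * b) - exp (- d * h)) * (1 / (1 - exp (- d * h))))"
    by (simp only: sums_mult)
  moreover have "(\<lambda>r. prob (Ev r)) sums prob (\<Union>r. Ev r)"
  proof (rule finite_measure_UNION)
    have "Ev r \<inter> Ev r' = {}" if "r < r'" for r r'
    proof -
      have "C r \<subseteq> A r'"
      proof -
        have "- real (m + r') * d \<le> - real (m + r + 1) * d"
          using that d by (intro mult_right_mono) auto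
        then show ?thesis using neg[of r] by (auto simp: A_def C_def during_def)
      qed
      moreover have "D r \<subseteq> C r" "A r \<subseteq> A r'"
      proof -
        show "D r \<subseteq> C r" by (rule DC)
        have "- real (m + r') * d \<le> - real (m + r) * d"
          using that d by (intro mult_right_mono) auto
        then show "A r \<subseteq> A r'" by (auto simp: A_def during_def)
      qed
      ultimately show ?thesis by (fastforce simp: Ev_def V_def W_def void_def)
    qed
    then show "disjoint_family Ev"
      unfolding disjoint_family_on_def by (metis Int_commute linorder_neqE_nat)
  qed auto
  moreover have "void B \<inter> slotted_event H G d (Suc k) m = (\<Union>r. Ev r)"
    unfolding slotted_event_Suc A_def[symmetric] C_def[symmetric] D_def[symmetric] Ev_def V_def W_def
    using DC by (fastforce simp: void_def)
  ultimately show ?case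
    by (simp add: sums_unique2 c_def h_def b_def field_simps)
qed

end

text \<open>
  \<open>1 - exp (- m) * (1 + m) \<le> m\<^sup>2\<close>, because \<open>exp (- m) \<ge> 1 - m\<close>.
\<close>

lemma two_points_probability_le:
  assumes M: "prob_space M" and pp: "poisson_process M \<mu> Z"
    and A: "A \<in> sets \<mu>" "emeasure \<mu> A < \<infinity>"
  shows "measure M {\<omega> \<in> space M. 2 \<le> card {i. Z i \<omega> \<in> A}} \<le> (measure \<mu> A)\<^sup>2"
proof -
  interpret prob_space M by fact
  let ?N = "\<lambda>\<omega>. card {i. Z i \<omega> \<in> A}" and ?m = "measure \<mu> A"
  have [measurable]: "?N \<in> measurable M (count_space UNIV)"
    by (rule poisson_count_measurable[OF M pp A])
  have law: "measure M {\<omega> \<in> space M. ?N \<omega> = k} = exp (- ?m) * ?m ^ k / fact k" for k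
    using pp A unfolding poisson_process_def by blast
  have "{\<omega> \<in> space M. 2 \<le> ?N \<omega>} = space M - ({\<omega> \<in> space M. ?N \<omega> = 0} \<union> {\<omega> \<in> space M. ?N \<omega> = 1})"
    by auto
  then have "measure M {\<omega> \<in> space M. 2 \<le> ?N \<omega>} =
      1 - prob ({\<omega> \<in> space M. ?N \<omega> = 0} \<union> {\<omega> \<in> space M. ?N \<omega> = 1})"
    by (simp add: prob_compl)
  also have "prob ({\<omega> \<in> space M. ?N \<omega> = 0} \<union> {\<omega> \<in> space M. ?N \<omega> = 1}) = exp (- ?m) + exp (- ?m) * ?m"
    by (subst finite_measure_Union) (auto simp: law)
  also have "1 - (exp (- ?m) + exp (- ?m) * ?m) \<le> ?m\<^sup>2"
  proof -
    have "(1 - ?m) * (1 + ?m) \<le> exp (- ?m) * (1 + ?m)"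
      using exp_ge_add_one_self[of "- ?m"] by (intro mult_right_mono) auto
    then show ?thesis by (simp add: algebra_simps power2_eq_square)
  qed
  finally show ?thesis .
qed

lemma slot_ratio_tendsto:
  fixes b h :: real
  assumes "0 < h"
  shows "(\<lambda>N. (exp (- (1 / real (Suc N)) * b) - exp (- (1 / real (Suc N)) * h)) /
      (1 - exp (- (1 / real (Suc N)) * h))) \<longlonglongrightarrow> (h - b) / h"
proof -
  define d where "d N = 1 / real (Suc N)" for N
  have d0: "d N \<noteq> 0" for N by (simp add: d_def)
  have d: "filterlim d (at 0) sequentially"
    unfolding d_def by real_asymp
  have D: "((\<lambda>x. (exp (- x * c) - 1) / x) \<longlongrightarrow> - c) (at 0)" for c :: real
  proof -
    have "((\<lambda>x. exp (- x * c)) has_real_derivative - c) (at 0)"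
      by (auto intro!: derivative_eq_intros)
    then show ?thesis by (simp add: has_field_derivative_iff)
  qed
  have L: "(\<lambda>N. (exp (- d N * c) - 1) / d N) \<longlonglongrightarrow> - c" for c
    by (rule filterlim_compose[OF D d])
  have "(\<lambda>N. ((exp (- d N * b) - 1) / d N - (exp (- d N * h) - 1) / d N) / (- ((exp (- d N * h) - 1) / d N)))
      \<longlonglongrightarrow> (- b - (- h)) / (- (- h))"
    using assms by (intro tendsto_intros L) auto
  moreover have "((exp (- d N * b) - 1) / d N - (exp (- d N * h) - 1) / d N) / (- ((exp (- d N * h) - 1) / d N)) =
      (exp (- d N * b) - exp (- d N * h)) / (1 - exp (- d N * h))" for N
    using d0[of N] by (simp add: divide_simps) (simp add: algebra_simps)
  ultimately show ?thesis by (simp add: d_def)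
qed

context marked_poisson_in_time
begin

lemma time_measurable [measurable]: "(\<lambda>\<omega>. time \<omega> i) \<in> borel_measurable M"
  unfolding time_def using measurable_compose[OF points_measurable measurable_snd] by simp

lemma location_measurable [measurable]: "(\<lambda>\<omega>. fst (Z i \<omega>)) \<in> measurable M \<kappa>"
  by (rule measurable_compose[OF points_measurable measurable_fst])

text \<open>
  Two points with equal times in a bounded part of space-time lie in a common slot of length \<open>1 / r\<close>.
  There are of order \<open>r\<close> slots, and each contains two points with probability of order
  \<open>1 / r\<^sup>2\<close>.
\<close>

lemma distinct_times: "AE \<omega> in M. inj (time \<omega>)"
proof -
  obtain S :: "nat \<Rightarrow> 'a set" where S: "range S \<subseteq> sets \<kappa>" "(\<Union>k. S k) = space \<kappa>"
    "\<And>k. emeasure \<kappa> (S k) \<noteq> \<infinity>" "incseq S"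
    using locations.sigma_finite_incseq by blast
  have [measurable]: "S k \<in> sets \<kappa>" for k using S(1) by auto
  define tie where "tie k i j = {\<omega> \<in> space M. fst (Z i \<omega>) \<in> S k \<and> fst (Z j \<omega>) \<in> S k \<and>
      time \<omega> i \<in> {- real k..<real k} \<and> time \<omega> i = time \<omega> j}" for k i j
  have [measurable]: "tie k i j \<in> sets M" for k i j
    unfolding tie_def by measurable
  have "prob (\<Union>i. \<Union>j\<in>-{i}. tie k i j) \<le> 0" for k
  proof (rule LIMSEQ_le_const)
    define c where "c = measure \<kappa> (S k)"
    show "(\<lambda>r. 2 * real k * c\<^sup>2 / real (Suc r)) \<longlonglongrightarrow> 0"
      by real_asymp
    have "prob (\<Union>i. \<Union>j\<in>-{i}. tie k i j) \<le> 2 * real k * c\<^sup>2 / real (Suc r)" for r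
    proof -
      define I where "I l = {- real k + real l / real (Suc r) ..< - real k + real (Suc l) / real (Suc r)}" for l
      define A where "A l = S k \<times> I l" for l
      define two where "two l = {\<omega> \<in> space M. 2 \<le> card {i. Z i \<omega> \<in> A l}}" for l
      have A_sets[measurable]: "A l \<in> sets (\<kappa> \<Otimes>\<^sub>M lborel)" for l
        unfolding A_def I_def by measurable
      have emA: "emeasure (\<kappa> \<Otimes>\<^sub>M lborel) (A l) = ennreal (c / real (Suc r))" for l
      proof -
        have "emeasure lborel (I l) = ennreal (1 / real (Suc r))"
          unfolding I_def by (subst emeasure_lborel_Ico) (auto simp: divide_simps)
        moreover have "emeasure \<kappa> (S k) = ennreal c"
          using S(3) by (simp add: c_def emeasure_eq_ennreal_measure)
        ultimately show ?thesis
          unfolding A_def by (subst lborel.emeasure_pair_measure_Times) (auto simp: I_def c_def ennreal_mult[symmetric])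
      qed
      then have A_fin: "emeasure (\<kappa> \<Otimes>\<^sub>M lborel) (A l) < \<infinity>" for l by simp
      have two_le: "prob (two l) \<le> (c / real (Suc r))\<^sup>2" for l
        using two_points_probability_le[OF prob_space_axioms poisson A_sets A_fin, of l] emA[of l]
        by (simp add: two_def measure_def c_def)
      have [measurable]: "two l \<in> sets M" for l
        unfolding two_def
        using poisson_count_measurable[OF prob_space_axioms poisson A_sets A_fin, of l] by measurable
      have "AE \<omega> in M. \<forall>l. finite {i. Z i \<omega> \<in> A l}"
        using poisson A_fin A_sets unfolding poisson_process_def AE_all_countable by blast
      then have "AE \<omega> in M. \<omega> \<in> (\<Union>i. \<Union>j\<in>-{i}. tie k i j) \<longrightarrow> \<omega> \<in> (\<Union>l<2 * k * Suc r. two l)"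
      proof eventually_elim
        fix \<omega> assume fin: "\<forall>l. finite {i. Z i \<omega> \<in> A l}"
        show "\<omega> \<in> (\<Union>i. \<Union>j\<in>-{i}. tie k i j) \<longrightarrow> \<omega> \<in> (\<Union>l<2 * k * Suc r. two l)"
        proof
          assume "\<omega> \<in> (\<Union>i. \<Union>j\<in>-{i}. tie k i j)"
          then obtain i j where "j \<in> - {i}" "\<omega> \<in> tie k i j" by blast
          then have ij: "i \<noteq> j" "\<omega> \<in> tie k i j" by auto
          \<comment> \<open>\<open>y\<close> is the position of the time on the grid with spacing \<open>1 / Suc r\<close> that starts at \<open>- k\<close>.\<close>
          define y where "y = (time \<omega> i + real k) * real (Suc r)"
          define l where "l = nat \<lfloor>y\<rfloor>"
          have t: "- real k \<le> time \<omega> i" "time \<omega> i < real k" using ij by (auto simp: tie_def)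
          then have "0 \<le> y" unfolding y_def by simp
          then have ly: "real l \<le> y" "y < real (Suc l)" unfolding l_def by linarith+
          have "time \<omega> i = y / real (Suc r) - real k" by (simp add: y_def)
          moreover have "real l / real (Suc r) \<le> y / real (Suc r)" "y / real (Suc r) < real (Suc l) / real (Suc r)"
            using ly by (auto intro: divide_right_mono divide_strict_right_mono)
          ultimately have "time \<omega> i \<in> I l" unfolding I_def by auto
          then have "{i, j} \<subseteq> {i. Z i \<omega> \<in> A l}"
            using ij by (auto simp: A_def tie_def time_def mem_Times_iff)
          then have "card {i, j} \<le> card {i. Z i \<omega> \<in> A l}" using fin by (intro card_mono) auto
          then have "\<omega> \<in> two l" using ij by (auto simp: two_def tie_def)
          have "y < (2 * real k) * real (Suc r)"
            unfolding y_def using t by (intro mult_strict_right_mono) auto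
          moreover have "(2 * real k) * real (Suc r) = real (2 * k * Suc r)" by (simp add: algebra_simps)
          ultimately have "real l < real (2 * k * Suc r)" using ly by linarith
          then have "l < 2 * k * Suc r" unfolding of_nat_less_iff .
          then show "\<omega> \<in> (\<Union>l<2 * k * Suc r. two l)" using \<open>\<omega> \<in> two l\<close> by blast
        qed
      qed
      then have "prob (\<Union>i. \<Union>j\<in>-{i}. tie k i j) \<le> prob (\<Union>l<2 * k * Suc r. two l)"
        by (intro finite_measure_mono_AE) auto
      also have "\<dots> \<le> (\<Sum>l<2 * k * Suc r. prob (two l))"
        by (intro finite_measure_subadditive_finite) auto
      also have "\<dots> \<le> (\<Sum>l<2 * k * Suc r. (c / real (Suc r))\<^sup>2)"
        by (intro sum_mono two_le)
      also have "\<dots> = real (2 * k * Suc r) * (c / real (Suc r))\<^sup>2"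
        by simp
      also have "real (2 * k * Suc r) = 2 * real k * real (Suc r)"
        by (simp add: algebra_simps)
      also have "2 * real k * real (Suc r) * (c / real (Suc r))\<^sup>2 = 2 * real k * c\<^sup>2 / real (Suc r)"
        by (simp add: power2_eq_square del: of_nat_Suc)
      finally show ?thesis .
    qed
    then show "\<exists>r0. \<forall>r\<ge>r0. prob (\<Union>i. \<Union>j\<in>-{i}. tie k i j) \<le> 2 * real k * c\<^sup>2 / real (Suc r)"
      by blast
  qed
  then have "prob (\<Union>i. \<Union>j\<in>-{i}. tie k i j) = 0" for k
    by (intro antisym) auto
  then have "AE \<omega> in M. \<omega> \<notin> (\<Union>i. \<Union>j\<in>-{i}. tie k i j)" for k
    by (subst prob_eq_0[symmetric]) auto
  then have "AE \<omega> in M. \<forall>k. \<omega> \<notin> (\<Union>i. \<Union>j\<in>-{i}. tie k i j)"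
    by (simp only: AE_all_countable) simp
  then show ?thesis
    using AE_space
  proof eventually_elim
    fix \<omega> assume no: "\<forall>k. \<omega> \<notin> (\<Union>i. \<Union>j\<in>-{i}. tie k i j)" and \<omega>: "\<omega> \<in> space M"
    show "inj (time \<omega>)"
    proof (rule injI, rule ccontr)
      fix i j assume eq: "time \<omega> i = time \<omega> j" "i \<noteq> j"
      have "fst (Z l \<omega>) \<in> (\<Union>k. S k)" for l
        using measurable_space[OF points_measurable \<omega>, of l] S(2) by (auto simp: space_pair_measure)
      then obtain p q where pq: "fst (Z i \<omega>) \<in> S p" "fst (Z j \<omega>) \<in> S q" by blast
      define k where "k = max (max p q) (Suc (nat \<lceil>\<bar>time \<omega> i\<bar>\<rceil>))"
      have "S p \<subseteq> S k" "S q \<subseteq> S k" using S(4) by (auto simp: k_def incseq_def)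
      moreover have "\<bar>time \<omega> i\<bar> < real k" unfolding k_def by linarith
      ultimately have "\<omega> \<in> tie k i j" using pq eq \<omega> by (auto simp: tie_def)
      then have "\<omega> \<in> (\<Union>i. \<Union>j\<in>-{i}. tie k i j)"
        using eq(2) by (intro UN_I[of i] UN_I[of j]) auto
      then show False using no[rule_format, of k] by contradiction
    qed
  qed
qed

text \<open>
  With \<open>b = |H k - G k|\<close> and \<open>h = |H k|\<close>, each factor of the probability of the slotted event tends to
  \<open>(h - b) / h = |G k| / |H k|\<close>, and the slotted events converge to the event that there is a chain
  wherever times are distinct and locally finite. The event \<open>E\<close> stands for an event that is described
  by chains outside a null set only, as the inclusion of compact sets in visible parts is.
\<close>

theorem latest_chain_probability:
  assumes H: "\<And>k. k < n \<Longrightarrow> H k \<in> sets (\<kappa> \<Otimes>\<^sub>M N)" "\<And>k. k < n \<Longrightarrow> emeasure (\<kappa> \<Otimes>\<^sub>M N) (H k) < \<infinity>"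
      "\<And>k. k < n \<Longrightarrow> 0 < measure (\<kappa> \<Otimes>\<^sub>M N) (H k)"
    and G: "\<And>k. k < n \<Longrightarrow> G k \<in> sets (\<kappa> \<Otimes>\<^sub>M N)" "\<And>k. k < n \<Longrightarrow> G k \<subseteq> H k"
    and mono: "\<And>k. Suc k < n \<Longrightarrow> H k \<subseteq> H (Suc k)"
    and GH: "\<And>k. Suc k < n \<Longrightarrow> G (Suc k) \<inter> H k = {}"
    and E: "E \<in> sets M" "AE \<omega> in M. \<omega> \<in> E \<longleftrightarrow> latest_chain (time \<omega>) (of_kind H \<omega>) (of_kind G \<omega>) n 0"
  shows "prob E = (\<Prod>k<n. measure (\<kappa> \<Otimes>\<^sub>M N) (G k) / measure (\<kappa> \<Otimes>\<^sub>M N) (H k))"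
proof -
  define S where "S r = slotted_event H G (1 / real (Suc r)) n 0" for r
  have [measurable]: "S r \<in> sets M" for r
    unfolding S_def by (intro slotted_event_measurable H G)
  have prob_S: "prob (S r) = (\<Prod>k<n. (exp (- (1 / real (Suc r)) * measure (\<kappa> \<Otimes>\<^sub>M N) (H k - G k)) -
      exp (- (1 / real (Suc r)) * measure (\<kappa> \<Otimes>\<^sub>M N) (H k))) /
      (1 - exp (- (1 / real (Suc r)) * measure (\<kappa> \<Otimes>\<^sub>M N) (H k))))" for r
  proof -
    have "prob (void {} \<inter> S r) = exp (- measure ((\<kappa> \<Otimes>\<^sub>M lborel) \<Otimes>\<^sub>M N) {}) * (\<Prod>k<n. (exp (- (1 / real (Suc r)) * measure (\<kappa> \<Otimes>\<^sub>M N) (H k - G k)) -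
      exp (- (1 / real (Suc r)) * measure (\<kappa> \<Otimes>\<^sub>M N) (H k))) /
      (1 - exp (- (1 / real (Suc r)) * measure (\<kappa> \<Otimes>\<^sub>M N) (H k))))"
      unfolding S_def
      using slotted_event_probability[where n=n and k=n and m=0 and B="{}" and d="1 / real (Suc r)" and H=H and G=G] H G
      by simp
    moreover have "void {} \<inter> S r = S r"
      by (auto simp: void_def S_def slotted_event_def)
    ultimately show ?thesis by simp
  qed
  have diff: "measure (\<kappa> \<Otimes>\<^sub>M N) (H k) - measure (\<kappa> \<Otimes>\<^sub>M N) (H k - G k) = measure (\<kappa> \<Otimes>\<^sub>M N) (G k)"
    if "k < n" for k
    using measure_Diff[of "\<kappa> \<Otimes>\<^sub>M N" "H k" "G k"] H(1,2)[OF that] G[OF that] by simp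
  have "(\<lambda>r. prob (S r)) \<longlonglongrightarrow> (\<Prod>k<n. measure (\<kappa> \<Otimes>\<^sub>M N) (G k) / measure (\<kappa> \<Otimes>\<^sub>M N) (H k))"
    unfolding prob_S
  proof (rule tendsto_prod)
    fix k assume "k \<in> {..<n}"
    then show "(\<lambda>r. (exp (- (1 / real (Suc r)) * measure (\<kappa> \<Otimes>\<^sub>M N) (H k - G k)) -
      exp (- (1 / real (Suc r)) * measure (\<kappa> \<Otimes>\<^sub>M N) (H k))) /
      (1 - exp (- (1 / real (Suc r)) * measure (\<kappa> \<Otimes>\<^sub>M N) (H k))))
      \<longlonglongrightarrow> measure (\<kappa> \<Otimes>\<^sub>M N) (G k) / measure (\<kappa> \<Otimes>\<^sub>M N) (H k)"
      using slot_ratio_tendsto[OF H(3), of k "measure (\<kappa> \<Otimes>\<^sub>M N) (H k - G k)"] diff by simp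
  qed
  moreover have "(\<lambda>r. prob (S r)) \<longlonglongrightarrow> prob E"
  proof -
    have fin: "AE \<omega> in M. \<forall>k\<in>{..<n}. \<forall>a. finite {i \<in> of_kind H \<omega> k. time \<omega> i \<in> {- real a..<0}}"
    proof (intro AE_finite_allI, simp, subst AE_all_countable, intro allI)
      fix k a assume k: "k \<in> {..<n}"
      have "AE \<omega> in M. finite {i. (Z i \<omega>, L i \<omega>) \<in> during {- real a..<0} (H k)}"
        using k H(1,2)[of k]
        by (intro finitely_many_marked_points) (auto simp: emeasure_during ennreal_mult_less_top simp del: sets_lborel)
      then show "AE \<omega> in M. finite {i \<in> of_kind H \<omega> k. time \<omega> i \<in> {- real a..<0}}"
        by (rule AE_mp) (auto intro!: AE_I2 elim!: rev_finite_subset simp: during_def of_kind_def time_def)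
    qed
    have "AE \<omega> in M. (\<lambda>r. indicator (S r) \<omega> :: real) \<longlonglongrightarrow> indicator E \<omega>"
      using fin distinct_times E(2) AE_space
    proof eventually_elim
      fix \<omega>
      let ?T = "time \<omega>" and ?H = "of_kind H \<omega>" and ?G = "of_kind G \<omega>"
      assume fin: "\<forall>k\<in>{..<n}. \<forall>a. finite {i \<in> ?H k. ?T i \<in> {- real a..<0}}"
        and inj: "inj ?T" and E: "\<omega> \<in> E \<longleftrightarrow> latest_chain ?T ?H ?G n 0" and \<omega>: "\<omega> \<in> space M"
      have fin': "finite {i \<in> ?H k. ?T i \<in> {a..<0}}" if "k < n" for k a
      proof -
        have "{i \<in> ?H k. ?T i \<in> {a..<0}} \<subseteq> {i \<in> ?H k. ?T i \<in> {- real (nat \<lceil>- a\<rceil>)..<0}}"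
          by (auto; linarith)
        then show ?thesis using fin that by (blast intro: finite_subset)
      qed
      have "eventually (\<lambda>r. \<omega> \<in> S r \<longleftrightarrow> \<omega> \<in> E) sequentially"
      proof (cases "\<omega> \<in> E")
        case False
        have "\<omega> \<notin> S r" for r
        proof
          assume "\<omega> \<in> S r"
          then have "slotted_chain ?T ?H ?G (1 / real (Suc r)) n 0" by (simp add: S_def slotted_event_def)
          then have "latest_chain ?T ?H ?G n (- real 0 * (1 / real (Suc r)))"
            using fin' GH mono
            by (intro slotted_chain_imp_latest_chain[where n=n]) (fastforce simp: of_kind_def)+
          then show False using False E by simp
        qed
        then show ?thesis using False by simp
      next
        case True
        have "\<exists>e>0. \<forall>d m. 0 < d \<longrightarrow> d < e \<longrightarrow> - real m * d \<le> 0 \<longrightarrow> 0 < - real m * d + d \<longrightarrow>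
            slotted_chain ?T ?H ?G d n m"
        proof (rule latest_chain_imp_slotted_chain[of n])
          show "?G k \<subseteq> ?H k" if "k < n" for k using G(2)[OF that] by (auto simp: of_kind_def)
        qed (use fin' inj E True in auto)
        then obtain e where e: "e > 0" "\<And>d m. \<lbrakk>0 < d; d < e; - real m * d \<le> 0; 0 < - real m * d + d\<rbrakk>
            \<Longrightarrow> slotted_chain ?T ?H ?G d n m"
          by blast
        have "eventually (\<lambda>r. 1 / real (Suc r) < e) sequentially"
          using e(1) by real_asymp
        then show ?thesis
          proof eventually_elim
          fix r assume "1 / real (Suc r) < e"
          then have "slotted_chain ?T ?H ?G (1 / real (Suc r)) n 0" by (intro e(2)) auto
          then show "\<omega> \<in> S r \<longleftrightarrow> \<omega> \<in> E" using True \<omega> by (simp add: S_def slotted_event_def)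
        qed
      qed
      then show "(\<lambda>r. indicator (S r) \<omega> :: real) \<longlonglongrightarrow> indicator E \<omega>"
        by (intro tendsto_eventually) (auto elim!: eventually_mono simp: indicator_def)
    qed
    then have "(\<lambda>r. \<integral>\<omega>. indicator (S r) \<omega> \<partial>M) \<longlonglongrightarrow> (\<integral>\<omega>. indicator E \<omega> \<partial>M :: real)"
      using E(1) by (intro integral_dominated_convergence[where w="\<lambda>_. 1"]) auto
    then show ?thesis using E(1) by simp
  qed
  ultimately show ?thesis by (rule LIMSEQ_unique[rotated])
qed

end

section \<open>Measurability for the Fell topology\<close>

lemma compact_miss_measurable:
  "compact K \<Longrightarrow> {F. closed F \<and> F \<inter> K = {}} \<in> sets fell_borel"
  unfolding sets_fell_borel fell_topology_def
  by (intro sigma_sets.Basic CollectI topology_generated_by_Basis) blast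

lemma open_hit_measurable:
  "open U \<Longrightarrow> {F. closed F \<and> F \<inter> U \<noteq> {}} \<in> sets fell_borel"
  unfolding sets_fell_borel fell_topology_def
  by (intro sigma_sets.Basic CollectI topology_generated_by_Basis) blast

definition hitting :: "'a::real_normed_vector set \<Rightarrow> ('a \<times> 'a set) set" where
  "hitting C = {(y, F). closed F \<and> (+) y ` F \<inter> C \<noteq> {}}"

definition covering :: "'a::real_normed_vector set \<Rightarrow> ('a \<times> 'a set) set" where
  "covering K = {(y, F). closed F \<and> K \<subseteq> (+) y ` interior F}"

text \<open>
  If the translate of \<open>F\<close> by \<open>y\<close> misses the compact set \<open>C\<close>, it does so with positive distance.
  Hence it is enough to test points \<open>q\<close> of a countable dense set close to \<open>y\<close> against slightly
  fattened translates of \<open>C\<close>, and each test is a measurable rectangle.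
\<close>

lemma hitting_measurable [measurable]:
  fixes C :: "'a::euclidean_space set"
  assumes C: "compact C"
  shows "hitting C \<in> sets (lborel \<Otimes>\<^sub>M fell_borel)"
proof -
  obtain D :: "'a set" where D: "countable D" "\<And>U. open U \<Longrightarrow> U \<noteq> {} \<Longrightarrow> \<exists>d\<in>D. d \<in> U"
    using countable_dense_setE by blast
  define e where "e n = 1 / real (Suc n)" for n
  define fat where "fat q n = {u + v |u v. u \<in> (\<lambda>c. c - q) ` C \<and> v \<in> cball 0 (e n)}" for q :: 'a and n
  have e0: "0 < e n" for n by (simp add: e_def)
  have fat: "compact (fat q n)" for q n
    unfolding fat_def
    by (intro compact_sums compact_cball compact_continuous_image[OF _ C] continuous_intros)
  have "{(y, F). closed F \<and> (+) y ` F \<inter> C = {}} =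
      (\<Union>q\<in>D. \<Union>n. ball q (e n) \<times> {F. closed F \<and> F \<inter> fat q n = {}})"
  proof (intro equalityI subsetI; clarsimp)
    fix y and F :: "'a set" assume F: "closed F" and miss: "(+) y ` F \<inter> C = {}"
    have "(\<lambda>c. c - y) ` C \<inter> F = {}"
      using miss by (auto simp: disjoint_iff)
    moreover have "compact ((\<lambda>c. c - y) ` C)"
      by (intro compact_continuous_image[OF _ C] continuous_intros)
    ultimately obtain d where d: "d > 0" "\<forall>u\<in>(\<lambda>c. c - y) ` C. \<forall>v\<in>F. d \<le> dist u v"
      using separate_compact_closed[OF _ F] by blast
    obtain n where "e n < d / 2"
      using reals_Archimedean[of "d / 2"] d(1) by (auto simp: e_def inverse_eq_divide)
    obtain q where q: "q \<in> D" "q \<in> ball y (e n)"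
      using D(2)[of "ball y (e n)"] e0[of n] by auto
    have "F \<inter> fat q n = {}"
    proof (rule ccontr)
      assume "F \<inter> fat q n \<noteq> {}"
      then obtain c v where cv: "c \<in> C" "norm v \<le> e n" "c - q + v \<in> F" by (auto simp: fat_def)
      then have "d \<le> dist (c - y) (c - q + v)" using d(2) by blast
      also have "\<dots> = norm ((q - y) - v)" by (simp add: dist_norm algebra_simps)
      also have "\<dots> \<le> norm (q - y) + norm v" by (rule norm_triangle_ineq4)
      also have "\<dots> < d" using q(2) cv(2) \<open>e n < d / 2\<close> by (simp add: dist_norm norm_minus_commute)
      finally show False by simp
    qed
    then show "\<exists>q\<in>D. \<exists>n. dist q y < e n \<and> F \<inter> fat q n = {}"
      using q by (auto simp: dist_commute)
  next
    fix q y n and F :: "'a set" assume "dist q y < e n" and F: "closed F" "F \<inter> fat q n = {}"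
    show "(+) y ` F \<inter> C = {}"
    proof (rule ccontr)
      assume "(+) y ` F \<inter> C \<noteq> {}"
      then obtain f where f: "f \<in> F" "y + f \<in> C" by auto
      have "y + f - q \<in> (\<lambda>c. c - q) ` C" "q - y \<in> cball 0 (e n)"
        using f(2) \<open>dist q y < e n\<close> by (auto simp: dist_norm norm_minus_commute)
      then have "(y + f - q) + (q - y) \<in> fat q n" unfolding fat_def by blast
      then have "f \<in> fat q n" by simp
      then show False using F f by auto
    qed
  qed
  also have "\<dots> \<in> sets (lborel \<Otimes>\<^sub>M fell_borel)"
    using D(1) by (intro sets.countable_UN' image_subsetI pair_measureI compact_miss_measurable fat) auto
  finally have "space (lborel \<Otimes>\<^sub>M fell_borel) - {(y, F). closed F \<and> (+) y ` F \<inter> C = {}}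
      \<in> sets (lborel \<Otimes>\<^sub>M fell_borel)"
    by (rule sets.compl_sets)
  also have "space (lborel \<Otimes>\<^sub>M fell_borel) - {(y, F). closed F \<and> (+) y ` F \<inter> C = {}} = hitting C"
    by (auto simp: hitting_def space_pair_measure space_fell_borel)
  finally show ?thesis .
qed

lemma compact_subset_open_iff:
  fixes K :: "'a::heine_borel set"
  assumes "compact K" "open U"
  shows "K \<subseteq> U \<longleftrightarrow> (\<exists>n. (\<Union>k\<in>K. ball k (1 / real (Suc n))) \<subseteq> U)"
proof
  assume "K \<subseteq> U"
  then obtain e where e: "e > 0" "(\<Union>k\<in>K. ball k e) \<subseteq> U"
    using compact_subset_open_imp_ball_epsilon_subset[OF assms] by blast
  obtain n where "1 / real (Suc n) < e"
    using reals_Archimedean[OF e(1)] by (auto simp: inverse_eq_divide)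
  then have "(\<Union>k\<in>K. ball k (1 / real (Suc n))) \<subseteq> U" using e(2) by fastforce
  then show "\<exists>n. (\<Union>k\<in>K. ball k (1 / real (Suc n))) \<subseteq> U" by blast
qed (fastforce simp: subset_iff)

text \<open>
  By compactness, \<open>K\<close> lies in the interior of a set exactly if some \<open>1 / (n + 1)\<close>-neighbourhood of \<open>K\<close>
  lies in the set. A closed set contains an open one as soon as it contains the points of a countable
  dense set in it, and containing a point is a hitting condition.
\<close>

lemma covering_measurable [measurable]:
  fixes K :: "'a::euclidean_space set"
  assumes K: "compact K"
  shows "covering K \<in> sets (lborel \<Otimes>\<^sub>M fell_borel)"
proof -
  obtain D :: "'a set" where D: "countable D" "\<And>U. open U \<Longrightarrow> U \<noteq> {} \<Longrightarrow> \<exists>d\<in>D. d \<in> U"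
    using countable_dense_setE by blast
  define U where "U n = (\<Union>k\<in>K. ball k (1 / real (Suc n)))" for n
  have U: "open (U n)" for n by (auto simp: U_def)
  have dense: "U n \<subseteq> S \<longleftrightarrow> D \<inter> U n \<subseteq> S" if S: "closed S" for S n
  proof
    assume *: "D \<inter> U n \<subseteq> S"
    have "U n - S = {}"
    proof (rule ccontr)
      assume "U n - S \<noteq> {}"
      then obtain d where "d \<in> D" "d \<in> U n - S" using D(2)[of "U n - S"] open_Diff[OF U[of n] S] by blast
      then show False using * by blast
    qed
    then show "U n \<subseteq> S" by blast
  qed blast
  have "covering K = (\<Union>n. {z \<in> space (lborel \<Otimes>\<^sub>M fell_borel). \<forall>q\<in>D \<inter> U n. z \<in> hitting {q}})"
  proof -
    have *: "K \<subseteq> (+) y ` interior F \<longleftrightarrow> (\<exists>n. \<forall>q\<in>D \<inter> U n. (y, F) \<in> hitting {q})" if F: "closed F" for y F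
    proof -
      have "K \<subseteq> (+) y ` interior F \<longleftrightarrow> (\<exists>n. U n \<subseteq> interior ((+) y ` F))"
        unfolding U_def interior_translation[symmetric] by (rule compact_subset_open_iff[OF K open_interior])
      also have "\<dots> \<longleftrightarrow> (\<exists>n. D \<inter> U n \<subseteq> (+) y ` F)"
        using dense[OF closed_translation[OF F]] U by (metis interior_maximal interior_subset subset_trans)
      also have "\<dots> \<longleftrightarrow> (\<exists>n. \<forall>q\<in>D \<inter> U n. (y, F) \<in> hitting {q})"
        using F by (auto simp: hitting_def)
      finally show ?thesis .
    qed
    have "(y, F) \<in> covering K \<longleftrightarrow> closed F \<and> (\<exists>n. \<forall>q\<in>D \<inter> U n. (y, F) \<in> hitting {q})" for y F
      by (cases "closed F") (simp_all add: covering_def *)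
    then show ?thesis
      by (auto simp: space_pair_measure space_fell_borel)
  qed
  also have "\<dots> \<in> sets (lborel \<Otimes>\<^sub>M fell_borel)"
  proof (intro sets.countable_UN image_subsetI)
    fix n
    have cnt: "countable (D \<inter> U n)" using D(1) by auto
    have [measurable]: "hitting {q} \<in> sets (lborel \<Otimes>\<^sub>M fell_borel)" for q :: 'a
      by (rule hitting_measurable) simp
    then show "{z \<in> space (lborel \<Otimes>\<^sub>M fell_borel). \<forall>q\<in>D \<inter> U n. z \<in> hitting {q}} \<in> sets (lborel \<Otimes>\<^sub>M fell_borel)"
      by (intro sets.sets_Collect_countable_All' cnt) measurable
  qed
  finally show ?thesis .
qed

lemma interior_hitting_measurable:
  fixes U :: "'a::euclidean_space set"
  assumes U: "open U"
  shows "{(y, F). closed F \<and> (+) y ` interior F \<inter> U \<noteq> {}} \<in> sets (lborel \<Otimes>\<^sub>M fell_borel)"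
proof -
  obtain D :: "'a set" where D: "countable D" "\<And>U. open U \<Longrightarrow> U \<noteq> {} \<Longrightarrow> \<exists>d\<in>D. d \<in> U"
    using countable_dense_setE by blast
  have "(+) y ` interior F \<inter> U \<noteq> {} \<longleftrightarrow> (\<exists>q\<in>D \<inter> U. q \<in> (+) y ` interior F)" for y F
    using D(2)[of "(+) y ` interior F \<inter> U"] U open_translation[OF open_interior, of y F] by blast
  then have "{(y, F). closed F \<and> (+) y ` interior F \<inter> U \<noteq> {}} = (\<Union>q\<in>D \<inter> U. covering {q})"
    by (auto simp: covering_def)
  also have "\<dots> \<in> sets (lborel \<Otimes>\<^sub>M fell_borel)"
    using D(1) by (intro sets.countable_UN' image_subsetI covering_measurable) auto
  finally show ?thesis .
qed

text \<open>
  \<open>F\<close> is the closure of its interior exactly if every basic open set that meets \<open>F\<close> meets its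
  interior. Measurability in the Fell sense is needed to transfer regularity from \<open>X\<close> to its copies,
  which only share its law.
\<close>

lemma regular_closed_measurable:
  "{F. closed F \<and> closure (interior F) = F} \<in> sets (fell_borel :: 'a::euclidean_space set measure)"
proof -
  obtain B :: "'a set set" where B: "countable B" "topological_basis B"
    using ex_countable_basis by blast
  have open_B: "open b" if "b \<in> B" for b using B(2) that by (rule topological_basis_open)
  have hit: "{F. closed F \<and> interior F \<inter> b \<noteq> {}} \<in> sets fell_borel" if "b \<in> B" for b
  proof -
    have "Pair 0 -` {(y, F). closed F \<and> (+) y ` interior F \<inter> b \<noteq> {}} \<in> sets fell_borel"
      using interior_hitting_measurable[OF open_B[OF that]] by (rule sets_Pair1)
    also have "Pair 0 -` {(y, F). closed F \<and> (+) y ` interior F \<inter> b \<noteq> {}} = {F. closed F \<and> interior F \<inter> b \<noteq> {}}"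
      by auto
    finally show ?thesis .
  qed
  have "closure (interior F) = F \<longleftrightarrow> (\<forall>b\<in>B. F \<inter> b \<noteq> {} \<longrightarrow> interior F \<inter> b \<noteq> {})" if F: "closed F" for F
  proof
    assume eq: "closure (interior F) = F"
    show "\<forall>b\<in>B. F \<inter> b \<noteq> {} \<longrightarrow> interior F \<inter> b \<noteq> {}"
      using eq open_B open_Int_closure_eq_empty by (metis Int_commute)
  next
    assume *: "\<forall>b\<in>B. F \<inter> b \<noteq> {} \<longrightarrow> interior F \<inter> b \<noteq> {}"
    have "F \<subseteq> closure (interior F)"
    proof (rule ccontr)
      assume "\<not> F \<subseteq> closure (interior F)"
      then obtain p where p: "p \<in> F" "p \<in> - closure (interior F)" by blast
      then obtain b where "b \<in> B" "p \<in> b" "b \<subseteq> - closure (interior F)"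
        using topological_basisE[OF B(2), of "- closure (interior F)" p] by auto
      then show False using * p closure_subset[of "interior F"] by blast
    qed
    then show "closure (interior F) = F"
      using F closure_minimal[OF interior_subset F] by blast
  qed
  then have "{F. closed F \<and> closure (interior F) = F} = {F \<in> space fell_borel. \<forall>b\<in>B.
      F \<in> {F. closed F \<and> F \<inter> b \<noteq> {}} \<longrightarrow> F \<in> {F. closed F \<and> interior F \<inter> b \<noteq> {}}}"
    by (auto simp: space_fell_borel)
  also have "\<dots> \<in> sets fell_borel"
  proof (intro sets.sets_Collect_countable_All' B(1))
    fix b assume "b \<in> B"
    then have [measurable]: "{F. closed F \<and> F \<inter> b \<noteq> {}} \<in> sets fell_borel"
      "{F. closed F \<and> interior F \<inter> b \<noteq> {}} \<in> sets fell_borel"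
      by (auto intro: hit open_hit_measurable open_B)
    show "{F \<in> space fell_borel. F \<in> {F. closed F \<and> F \<inter> b \<noteq> {}} \<longrightarrow>
        F \<in> {F. closed F \<and> interior F \<inter> b \<noteq> {}}} \<in> sets fell_borel"
      by measurable
  qed
  finally show ?thesis .
qed

section \<open>Mean areas as measures of sets of leaves\<close>

definition first_covering :: "'a::real_normed_vector set \<Rightarrow> 'a set \<Rightarrow> ('a \<times> 'a set) set" where
  "first_covering K C = covering K - hitting C"

lemma lborel_distr_reflection: "distr lborel borel uminus = (lborel :: 'a::euclidean_space measure)"
  by (subst (2) lborel_affine[of "-1" 0]) (auto simp: density_1 one_ennreal_def[symmetric])

text \<open>
  Fubini, followed by the reflection \<open>y \<mapsto> - y\<close>: leaves are placed by translating the shape, whereas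
  dilations and erosions collect the reflected positions.
\<close>

lemma emeasure_marks_eq_mean_area:
  fixes X :: "'p \<Rightarrow> (real^2) set"
  assumes X: "random_closed_set P X" and A: "A \<in> sets (lborel \<Otimes>\<^sub>M fell_borel)"
  shows "emeasure (lborel \<Otimes>\<^sub>M distr P fell_borel X) A = mean_area P (\<lambda>\<omega>. {y. (- y, X \<omega>) \<in> A})"
proof -
  have PX: "prob_space P" and Xm[measurable]: "X \<in> measurable P fell_borel"
    using X by (auto simp: random_closed_set_def)
  interpret N: prob_space "distr P fell_borel X"
    using PX Xm by (rule prob_space.prob_space_distr)
  interpret pair_sigma_finite "lborel :: (real^2) measure" "distr P fell_borel X" ..
  have A': "A \<in> sets (lborel \<Otimes>\<^sub>M distr P fell_borel X)"
    using A by (simp cong: sets_pair_measure_cong)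
  have meas: "(\<lambda>F. emeasure lborel ((\<lambda>y. (y, F)) -` A)) \<in> borel_measurable fell_borel"
    using measurable_emeasure_Pair2[OF A'] by simp
  have refl: "emeasure lborel ((\<lambda>y. (y, F)) -` A) = emeasure lborel {y. (- y, F) \<in> A}" for F
  proof -
    have S: "(\<lambda>y. (y, F)) -` A \<in> sets borel" using sets_Pair2[OF A] by simp
    have "emeasure lborel ((\<lambda>y. (y, F)) -` A) = emeasure (distr lborel borel uminus) ((\<lambda>y. (y, F)) -` A)"
      by (simp add: lborel_distr_reflection)
    also have "\<dots> = emeasure lborel (uminus -` ((\<lambda>y. (y, F)) -` A) \<inter> space lborel)"
      using S by (intro emeasure_distr) auto
    also have "uminus -` ((\<lambda>y. (y, F)) -` A) \<inter> space lborel = {y. (- y, F) \<in> A}" by auto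
    finally show ?thesis .
  qed
  have "emeasure (lborel \<Otimes>\<^sub>M distr P fell_borel X) A =
      (\<integral>\<^sup>+F. emeasure lborel ((\<lambda>y. (y, F)) -` A) \<partial>distr P fell_borel X)"
    by (rule emeasure_pair_measure_alt2[OF A'])
  also have "\<dots> = (\<integral>\<^sup>+\<omega>. emeasure lborel ((\<lambda>y. (y, X \<omega>)) -` A) \<partial>P)"
    by (rule nn_integral_distr[OF Xm]) (use meas in simp)
  finally show ?thesis by (simp add: mean_area_def refl)
qed

lemma hitting_reflected_section:
  assumes "closed F"
  shows "{y. (- y, F) \<in> hitting C} = F + reflection C"
proof (intro set_eqI iffI)
  fix y assume "y \<in> {y. (- y, F) \<in> hitting C}"
  then obtain f where "f \<in> F" "- y + f \<in> C" by (auto simp: hitting_def)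
  then have "- (- y + f) \<in> reflection C" unfolding reflection_def by (intro imageI)
  moreover have "y = f + - (- y + f)" by simp
  ultimately show "y \<in> F + reflection C" using \<open>f \<in> F\<close> set_plus_intro by metis
next
  fix y assume "y \<in> F + reflection C"
  then obtain f c where "f \<in> F" "c \<in> C" "y = f - c"
    by (auto simp: set_plus_def reflection_def)
  then have "c \<in> (+) (- y) ` F" by (intro image_eqI[of _ _ f]) auto
  then show "y \<in> {y. (- y, F) \<in> hitting C}" using assms \<open>c \<in> C\<close> by (auto simp: hitting_def)
qed

lemma covering_reflected_section:
  assumes "closed F"
  shows "{y. (- y, F) \<in> covering K} = interior F \<ominus> reflection K"
proof -
  have "K \<subseteq> (+) (- y) ` S \<longleftrightarrow> (+) y ` reflection (reflection K) \<subseteq> S" for y :: 'a and S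
  proof -
    have "reflection (reflection K) = K" by (auto simp: reflection_def image_image)
    moreover have "(+) (- y) ` S = {z. y + z \<in> S}"
    proof (intro set_eqI iffI)
      fix z assume "z \<in> {z. y + z \<in> S}"
      then show "z \<in> (+) (- y) ` S" by (intro image_eqI[of _ _ "y + z"]) auto
    qed auto
    ultimately show ?thesis by auto
  qed
  then show ?thesis using assms by (auto simp: covering_def erosion_def)
qed

lemma random_closed_set_closed:
  assumes "random_closed_set P X" "\<omega> \<in> space P"
  shows "closed (X \<omega>)"
  using assms measurable_space[of X P fell_borel \<omega>] by (simp add: random_closed_set_def space_fell_borel)

lemma emeasure_hitting:
  fixes X :: "'p \<Rightarrow> (real^2) set"
  assumes X: "random_closed_set P X" and C: "compact C"
  shows "emeasure (lborel \<Otimes>\<^sub>M distr P fell_borel X) (hitting C) = mean_area P (\<lambda>\<omega>. X \<omega> + reflection C)"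
  unfolding emeasure_marks_eq_mean_area[OF X hitting_measurable[OF C]] mean_area_def
  by (intro nn_integral_cong) (simp add: hitting_reflected_section random_closed_set_closed[OF X])

lemma emeasure_first_covering:
  fixes X :: "'p \<Rightarrow> (real^2) set"
  assumes X: "random_closed_set P X" and K: "compact K" and C: "compact C"
  shows "emeasure (lborel \<Otimes>\<^sub>M distr P fell_borel X) (first_covering K C) =
    mean_area P (\<lambda>\<omega>. (interior (X \<omega>) \<ominus> reflection K) \<inter> - (X \<omega> + reflection C))"
proof -
  have "{y. (- y, F) \<in> first_covering K C} = (interior F \<ominus> reflection K) \<inter> - (F + reflection C)"
    if "closed F" for F
    using hitting_reflected_section[OF that, of C] covering_reflected_section[OF that, of K]
    by (auto simp: first_covering_def)
  moreover have "first_covering K C \<in> sets (lborel \<Otimes>\<^sub>M fell_borel)"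
    unfolding first_covering_def by (intro sets.Diff covering_measurable hitting_measurable K C)
  ultimately show ?thesis
    unfolding emeasure_marks_eq_mean_area[OF X] mean_area_def
    by (simp add: emeasure_marks_eq_mean_area[OF X] mean_area_def random_closed_set_closed[OF X] cong: nn_integral_cong)
qed

lemma compact_reflection: "compact K \<Longrightarrow> compact (reflection K :: 'a::real_normed_vector set)"
  unfolding reflection_def by (rule compact_continuous_image) (auto intro: continuous_intros)

lemma emeasure_lborel_translation:
  fixes S :: "'a::euclidean_space set"
  assumes "S \<in> sets borel"
  shows "emeasure lborel ((+) a ` S) = emeasure lborel S"
proof -
  have "(+) a ` S = (+) (- a) -` S \<inter> space lborel"
  proof (intro set_eqI iffI)
    fix z assume "z \<in> (+) (- a) -` S \<inter> space lborel"
    then show "z \<in> (+) a ` S" by (intro image_eqI[of _ _ "- a + z"]) auto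
  qed auto
  then have "emeasure lborel ((+) a ` S) = emeasure (distr lborel borel ((+) (- a))) S"
    using assms by (simp add: emeasure_distr)
  then show ?thesis by (simp add: lborel_distr_plus)
qed

text \<open>
  The erosion of \<open>X\<close> by a disk is contained in a translate of \<open>X\<close>, and each point of \<open>C\<close> gives a
  translate of \<open>X\<close> that is contained in the dilation.
\<close>

lemma mean_area_dilation_pos:
  fixes X :: "'p \<Rightarrow> (real^2) set"
  assumes X: "random_closed_set P X" and C2: "condition_C2 P X" and C: "compact C" "C \<noteq> {}"
  shows "0 < mean_area P (\<lambda>\<omega>. X \<omega> + reflection C)"
proof -
  obtain c r where cr: "0 < r" "0 < mean_area P (\<lambda>\<omega>. X \<omega> \<ominus> cball c r)"
    using C2 by (auto simp: condition_C2_def)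
  obtain k where k: "k \<in> C" using C(2) by auto
  have "mean_area P (\<lambda>\<omega>. X \<omega> \<ominus> cball c r) \<le> mean_area P (\<lambda>\<omega>. X \<omega> + reflection C)"
    unfolding mean_area_def
  proof (rule nn_integral_mono)
    fix \<omega> assume "\<omega> \<in> space P"
    then have cl: "closed (X \<omega>)" by (rule random_closed_set_closed[OF X])
    have "X \<omega> \<ominus> cball c r \<subseteq> (+) c ` X \<omega>"
    proof
      fix y assume "y \<in> X \<omega> \<ominus> cball c r"
      then have "(+) y ` reflection (cball c r) \<subseteq> X \<omega>" by (simp add: erosion_def)
      moreover have "- c \<in> reflection (cball c r)" using cr(1) by (auto simp: reflection_def)
      ultimately have "y + - c \<in> X \<omega>" by blast
      then show "y \<in> (+) c ` X \<omega>" by (intro image_eqI[of _ _ "y - c"]) auto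
    qed
    then have "emeasure lborel (X \<omega> \<ominus> cball c r) \<le> emeasure lborel ((+) c ` X \<omega>)"
      using cl by (intro emeasure_mono) (auto intro!: borel_closed closed_translation)
    also have "\<dots> = emeasure lborel ((+) (- k) ` X \<omega>)"
      using cl by (simp only: emeasure_lborel_translation borel_closed)
    also have "\<dots> \<le> emeasure lborel (X \<omega> + reflection C)"
    proof (rule emeasure_mono)
      show "(+) (- k) ` X \<omega> \<subseteq> X \<omega> + reflection C"
      proof (rule image_subsetI)
        fix f assume "f \<in> X \<omega>"
        moreover have "- k \<in> reflection C" using k by (simp add: reflection_def)
        ultimately have "f + - k \<in> X \<omega> + reflection C" by (rule set_plus_intro)
        then show "- k + f \<in> X \<omega> + reflection C" by (simp add: add.commute)
      qed
      have "closed (\<Union>p\<in>X \<omega>. \<Union>q\<in>reflection C. {p + q})"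
        by (rule closed_compact_sums[OF cl compact_reflection[OF C(1)]])
      also have "(\<Union>p\<in>X \<omega>. \<Union>q\<in>reflection C. {p + q}) = X \<omega> + reflection C"
        unfolding set_plus_def by blast
      finally show "X \<omega> + reflection C \<in> sets lborel" by simp
    qed
    finally show "emeasure lborel (X \<omega> \<ominus> cball c r) \<le> emeasure lborel (X \<omega> + reflection C)" .
  qed
  with cr(2) show ?thesis by (rule less_le_trans)
qed

section \<open>Visible parts and most recent leaves\<close>

text \<open>
  The later leaves need not be locally finite, hence the uniform distance \<open>1 / (n + 1)\<close>. Since no
  exceptional set is involved, this gives measurability of the inclusion event itself and not only up
  to a null set.
\<close>

lemma subset_interior_visible_part_iff:
  fixes K :: "(real^2) set"
  assumes K: "compact K"
  shows "K \<subseteq> interior (visible_part x t L i \<omega>) \<longleftrightarrow>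
    K \<subseteq> (+) (x i \<omega>) ` interior (L i \<omega>) \<and>
    (\<exists>n. \<forall>l. t l \<omega> \<in> {t i \<omega><..<0} \<longrightarrow>
      (+) (x l \<omega>) ` interior (L l \<omega>) \<inter> (\<Union>k\<in>K. ball k (1 / real (Suc n))) = {})"
  (is "?lhs \<longleftrightarrow> ?cov \<and> (\<exists>n. ?free n)")
proof
  assume lhs: ?lhs
  have "visible_part x t L i \<omega> \<subseteq> (+) (x i \<omega>) ` L i \<omega>" by (auto simp: visible_part_def)
  then have "interior (visible_part x t L i \<omega>) \<subseteq> (+) (x i \<omega>) ` interior (L i \<omega>)"
    unfolding interior_translation[symmetric] by (rule interior_mono)
  then have ?cov using lhs by blast
  moreover obtain n where "(\<Union>k\<in>K. ball k (1 / real (Suc n))) \<subseteq> interior (visible_part x t L i \<omega>)"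
    using lhs compact_subset_open_iff[OF K open_interior] by blast
  then have "(\<Union>k\<in>K. ball k (1 / real (Suc n))) \<subseteq> visible_part x t L i \<omega>"
    using interior_subset by blast
  then have "?free n" unfolding visible_part_def by blast
  ultimately show "?cov \<and> (\<exists>n. ?free n)" by blast
next
  assume "?cov \<and> (\<exists>n. ?free n)"
  then obtain n where cov: ?cov and free: "?free n" by blast
  define U where "U = (+) (x i \<omega>) ` interior (L i \<omega>) \<inter> (\<Union>k\<in>K. ball k (1 / real (Suc n)))"
  have "open U" unfolding U_def by (intro open_Int open_translation open_interior open_UN ballI open_ball)
  moreover have "U \<subseteq> visible_part x t L i \<omega>"
    using free interior_subset[of "L i \<omega>"] unfolding U_def visible_part_def by blast
  moreover have "K \<subseteq> U" using cov by (auto simp: U_def)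
  ultimately show ?lhs using interior_maximal by blast
qed

lemma cumulative_union_mono: "j \<le> k \<Longrightarrow> cumulative_union K j \<subseteq> cumulative_union K k"
  unfolding cumulative_union_def by (intro UN_mono) auto

lemma compact_cumulative_union:
  "(\<And>j. j \<in> {1..k} \<Longrightarrow> compact (K j)) \<Longrightarrow> compact (cumulative_union K k)"
  unfolding cumulative_union_def by (intro compact_UN) auto

text \<open>
  A fixed compact neighbourhood of the sets \<open>K j\<close>: only the leaves that hit it can obstruct
  visibility near some \<open>K j\<close>, and there are finitely many of them in bounded time.
\<close>

definition unit_neighbourhood :: "'a::real_normed_vector set \<Rightarrow> 'a set" where
  "unit_neighbourhood C = {u + v |u v. u \<in> C \<and> v \<in> cball 0 1}"

lemma compact_unit_neighbourhood:
  "compact C \<Longrightarrow> compact (unit_neighbourhood C :: 'a::euclidean_space set)"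
  unfolding unit_neighbourhood_def by (intro compact_sums compact_cball)

lemma ball_subset_unit_neighbourhood:
  "c \<in> C \<Longrightarrow> r \<le> 1 \<Longrightarrow> ball c r \<subseteq> unit_neighbourhood C"
proof
  fix y assume "c \<in> C" "r \<le> 1" "y \<in> ball c r"
  then have "y = c + (y - c)" "y - c \<in> cball 0 1" by (auto simp: dist_norm norm_minus_commute)
  then show "y \<in> unit_neighbourhood C" using \<open>c \<in> C\<close> unfolding unit_neighbourhood_def by blast
qed

text \<open>
  From left to right, the crucial point is that an open set which misses the interior of a leaf misses
  the leaf, since the leaf is the closure of its interior. From right to left, local finiteness makes
  the union of the later leaves that hit the unit neighbourhood closed, so a compact set that misses it
  has a positive distance from it.
\<close>

lemma inclusion_iff_latest_chain:
  fixes x :: "nat \<Rightarrow> 'w \<Rightarrow> real^2"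
  assumes cl: "\<And>i. closed (L i \<omega>)" and reg: "\<And>i. closure (interior (L i \<omega>)) = L i \<omega>"
    and inj: "inj (\<lambda>i. t i \<omega>)" and nz: "\<And>i. t i \<omega> \<noteq> 0"
    and fin: "\<And>a. finite {i. (x i \<omega>, L i \<omega>) \<in> hitting (unit_neighbourhood (cumulative_union K n)) \<and> t i \<omega> \<in> {a..<0}}"
    and K: "\<And>j. j \<in> {1..n} \<Longrightarrow> compact (K j) \<and> K j \<noteq> {}"
  shows "(\<exists>i :: nat \<Rightarrow> nat. strict_mono_on {1..n} (\<lambda>j. t (i j) \<omega>) \<and>
      (\<forall>j\<in>{1..n}. t (i j) \<omega> \<le> 0 \<and> K j \<subseteq> interior (visible_part x t L (i j) \<omega>))) \<longleftrightarrow>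
    latest_chain (\<lambda>i. t i \<omega>) (\<lambda>k. {i. (x i \<omega>, L i \<omega>) \<in> hitting (cumulative_union K (Suc k))})
      (\<lambda>k. {i. (x i \<omega>, L i \<omega>) \<in> first_covering (K (Suc k)) (cumulative_union K k)}) n 0"
    (is "?lhs \<longleftrightarrow> latest_chain ?T ?H ?G n 0")
proof
  let ?leaf = "\<lambda>l. (+) (x l \<omega>) ` L l \<omega>"
  assume ?lhs
  then obtain i where i: "strict_mono_on {1..n} (\<lambda>j. t (i j) \<omega>)"
    and inc: "\<And>j. j \<in> {1..n} \<Longrightarrow> t (i j) \<omega> \<le> 0 \<and> K j \<subseteq> interior (visible_part x t L (i j) \<omega>)"
    by blast
  have neg: "t (i j) \<omega> < 0" if "j \<in> {1..n}" for j
    using inc[OF that] nz[of "i j"] by (simp add: order_le_less)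
  have miss: "?leaf l \<inter> K j = {}" if j: "j \<in> {1..n}" and l: "t (i j) \<omega> < t l \<omega>" "t l \<omega> < 0" for j l
  proof -
    let ?V = "visible_part x t L (i j) \<omega>"
    have "?V \<inter> (+) (x l \<omega>) ` interior (L l \<omega>) = {}" using l by (auto simp: visible_part_def)
    then have "interior ?V \<inter> (+) (x l \<omega>) ` interior (L l \<omega>) = {}" using interior_subset by blast
    then have "interior ?V \<inter> closure ((+) (x l \<omega>) ` interior (L l \<omega>)) = {}"
      using open_Int_closure_eq_empty[OF open_interior] by blast
    then have "interior ?V \<inter> ?leaf l = {}" by (simp add: closure_translation reg)
    then show ?thesis using inc[OF j] by blast
  qed
  have "k \<le> n \<Longrightarrow> s \<le> 0 \<Longrightarrow> (0 < k \<longrightarrow> t (i k) \<omega> < s) \<Longrightarrow> latest_chain ?T ?H ?G k s" for k s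
  proof (induction k arbitrary: s)
    case (Suc k)
    have kn: "Suc k \<in> {1..n}" using Suc.prems(1) by simp
    have less: "t (i j) \<omega> < t (i (Suc k)) \<omega>" if "j \<in> {1..k}" for j
      using i that kn by (intro strict_mono_onD[OF i]) auto
    have "i (Suc k) \<in> ?G k"
    proof -
      have "K (Suc k) \<subseteq> (+) (x (i (Suc k)) \<omega>) ` interior (L (i (Suc k)) \<omega>)"
        using inc[OF kn] subset_interior_visible_part_iff[OF K[OF kn, THEN conjunct1], of x t L "i (Suc k)" \<omega>]
        by simp
      moreover have "?leaf (i (Suc k)) \<inter> cumulative_union K k = {}"
      proof -
        have "?leaf (i (Suc k)) \<inter> K j = {}" if "j \<in> {1..k}" for j
          using that kn by (intro miss less neg) auto
        then show ?thesis unfolding cumulative_union_def by blast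
      qed
      ultimately show ?thesis using cl by (auto simp: first_covering_def covering_def hitting_def)
    qed
    moreover have "t l \<omega> \<notin> {t (i (Suc k)) \<omega><..<s}" if "l \<in> ?H k" for l
    proof
      assume T: "t l \<omega> \<in> {t (i (Suc k)) \<omega><..<s}"
      from that obtain j where j: "j \<in> {1..Suc k}" "?leaf l \<inter> K j \<noteq> {}"
        by (fastforce simp: hitting_def cumulative_union_def)
      have "t (i j) \<omega> \<le> t (i (Suc k)) \<omega>"
        using less[of j] j(1) by (cases "j = Suc k") auto
      then have "?leaf l \<inter> K j = {}"
        using T Suc.prems(2) j(1) kn by (intro miss) auto
      then show False using j(2) by contradiction
    qed
    moreover have "latest_chain ?T ?H ?G k (t (i (Suc k)) \<omega>)"
      using Suc.prems neg[OF kn] less[of k] by (intro Suc.IH) auto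
    ultimately show ?case using Suc.prems(3) unfolding latest_chain.simps by blast
  qed simp
  then show "latest_chain ?T ?H ?G n 0" using neg[of n] by auto
next
  let ?leaf = "\<lambda>l. (+) (x l \<omega>) ` L l \<omega>"
  assume chain: "latest_chain ?T ?H ?G n 0"
  have "?H j \<subseteq> ?H k" if "j \<le> k" for j k
    using cumulative_union_mono[of "Suc j" "Suc k" K] that by (auto simp: hitting_def)
  moreover have "?G (Suc k) \<inter> ?H k = {}" for k by (auto simp: first_covering_def)
  ultimately obtain i where i: "\<And>j. j < n \<Longrightarrow> i j \<in> ?G j \<and> t (i j) \<omega> < 0 \<and> (\<forall>l\<in>?H j. t l \<omega> \<notin> {t (i j) \<omega><..<0})"
    "\<And>j j'. j < j' \<Longrightarrow> j' < n \<Longrightarrow> t (i j) \<omega> < t (i j') \<omega>"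
    using latest_chain_witnesses[OF inj, of n ?G ?H n 0] chain by auto
  have "K (Suc j) \<subseteq> interior (visible_part x t L (i j) \<omega>)" if j: "j < n" for j
  proof -
    let ?N = "unit_neighbourhood (cumulative_union K n)"
    have Kj: "compact (K (Suc j))" "K (Suc j) \<subseteq> cumulative_union K n"
      using K[of "Suc j"] j by (auto simp: cumulative_union_def)
    define A where "A = {l. (x l \<omega>, L l \<omega>) \<in> hitting ?N \<and> t l \<omega> \<in> {t (i j) \<omega><..<0}}"
    have "A \<subseteq> {l. (x l \<omega>, L l \<omega>) \<in> hitting ?N \<and> t l \<omega> \<in> {t (i j) \<omega>..<0}}" by (auto simp: A_def)
    then have "finite A" using fin finite_subset by blast
    then have "open (- (\<Union>l\<in>A. ?leaf l))"
      by (intro open_Compl closed_UN ballI closed_translation cl)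
    moreover have "K (Suc j) \<subseteq> - (\<Union>l\<in>A. ?leaf l)"
    proof -
      have "l \<notin> ?H j" if "l \<in> A" for l using i(1)[OF j] that by (auto simp: A_def)
      then have "?leaf l \<inter> K (Suc j) = {}" if "l \<in> A" for l
        using that cl by (fastforce simp: hitting_def cumulative_union_def)
      then show ?thesis by blast
    qed
    ultimately have "\<exists>m. (\<Union>k\<in>K (Suc j). ball k (1 / real (Suc m))) \<subseteq> - (\<Union>l\<in>A. ?leaf l)"
      by (rule compact_subset_open_iff[OF Kj(1), THEN iffD1])
    then obtain m where m: "(\<Union>k\<in>K (Suc j). ball k (1 / real (Suc m))) \<subseteq> - (\<Union>l\<in>A. ?leaf l)" ..
    have "ball k (1 / real (Suc m)) \<subseteq> ?N" if "k \<in> K (Suc j)" for k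
      using that Kj(2) by (intro ball_subset_unit_neighbourhood) auto
    then have N: "(\<Union>k\<in>K (Suc j). ball k (1 / real (Suc m))) \<subseteq> ?N" by blast
    have "(+) (x l \<omega>) ` interior (L l \<omega>) \<inter> (\<Union>k\<in>K (Suc j). ball k (1 / real (Suc m))) = {}"
      if "t l \<omega> \<in> {t (i j) \<omega><..<0}" for l
    proof (cases "l \<in> A")
      case True
      then have "?leaf l \<inter> (\<Union>k\<in>K (Suc j). ball k (1 / real (Suc m))) = {}" using m by blast
      then show ?thesis using interior_subset[of "L l \<omega>"] by blast
    next
      case False
      then have "?leaf l \<inter> ?N = {}" using that cl by (auto simp: A_def hitting_def)
      then show ?thesis using interior_subset[of "L l \<omega>"] N by blast
    qed
    moreover have "K (Suc j) \<subseteq> (+) (x (i j) \<omega>) ` interior (L (i j) \<omega>)"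
      using i(1)[OF j] by (auto simp: first_covering_def covering_def)
    ultimately show ?thesis
      by (intro subset_interior_visible_part_iff[OF Kj(1), THEN iffD2] conjI exI[of _ m] allI impI)
  qed
  then have "K j \<subseteq> interior (visible_part x t L (i (j - 1)) \<omega>)" if "j \<in> {1..n}" for j
    using that by (cases j) auto
  moreover have "t (i (j - 1)) \<omega> \<le> 0" if "j \<in> {1..n}" for j
  proof -
    have "j - 1 < n" using that by auto
    then show ?thesis using i(1)[of "j - 1"] by (simp add: less_imp_le)
  qed
  moreover have "strict_mono_on {1..n} (\<lambda>j. t (i (j - 1)) \<omega>)"
    by (rule strict_mono_onI) (auto intro!: i(2))
  ultimately show ?lhs by (intro exI[of _ "\<lambda>j. i (j - 1)"]) auto
qed

text \<open>
  The choice of leaves matters only on \<open>{1..n}\<close>, so the event is a countable union.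
\<close>

lemma inclusion_event_measurable:
  fixes x :: "nat \<Rightarrow> 'w \<Rightarrow> real^2"
  assumes x: "\<And>i. x i \<in> borel_measurable M" and t: "\<And>i. t i \<in> borel_measurable M"
    and L: "\<And>i. L i \<in> measurable M fell_borel"
    and K: "\<And>j. j \<in> {1..n} \<Longrightarrow> compact (K j)"
  shows "inclusion_event M x t L n K \<in> sets M"
proof -
  note [measurable] = x t L
  have leaf[measurable]: "(\<lambda>\<omega>. (x i \<omega>, L i \<omega>)) \<in> measurable M (lborel \<Otimes>\<^sub>M fell_borel)" for i
    using x L by (intro measurable_Pair) auto
  have cl: "closed (L i \<omega>)" if "\<omega> \<in> space M" for i \<omega>
    using measurable_space[OF L that] by (simp add: space_fell_borel)
  define fit where "fit i j \<omega> \<longleftrightarrow> (x i \<omega>, L i \<omega>) \<in> covering (K j) \<and>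
      (\<exists>m. \<forall>l. t l \<omega> \<in> {t i \<omega><..<0} \<longrightarrow> (x l \<omega>, L l \<omega>) \<notin>
        {(y, F). closed F \<and> (+) y ` interior F \<inter> (\<Union>k\<in>K j. ball k (1 / real (Suc m))) \<noteq> {}})" for i j \<omega>
  have fit: "K j \<subseteq> interior (visible_part x t L i \<omega>) \<longleftrightarrow> fit i j \<omega>" if "\<omega> \<in> space M" "j \<in> {1..n}" for i j \<omega>
    unfolding subset_interior_visible_part_iff[OF K[OF that(2)]] fit_def
    using cl[OF that(1)] by (simp add: covering_def)
  have fit_meas: "{\<omega> \<in> space M. fit i j \<omega>} \<in> sets M" if "j \<in> {1..n}" for i j
  proof -
    have [measurable]: "covering (K j) \<in> sets (lborel \<Otimes>\<^sub>M fell_borel)"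
      by (rule covering_measurable[OF K[OF that]])
    have [measurable]: "{(y, F). closed F \<and> (+) y ` interior F \<inter> (\<Union>k\<in>K j. ball k (1 / real (Suc m))) \<noteq> {}}
        \<in> sets (lborel \<Otimes>\<^sub>M fell_borel)" for m
      by (intro interior_hitting_measurable open_UN ballI open_ball)
    show ?thesis unfolding fit_def greaterThanLessThan_iff by measurable
  qed
  have meas: "{\<omega> \<in> space M. t i \<omega> \<le> 0 \<and> fit i j \<omega>} \<in> sets M" if "j \<in> {1..n}" for i j
  proof -
    have "{\<omega> \<in> space M. t i \<omega> \<le> 0 \<and> fit i j \<omega>} = {\<omega> \<in> space M. t i \<omega> \<le> 0} \<inter> {\<omega> \<in> space M. fit i j \<omega>}"
      by auto
    then show ?thesis using fit_meas[OF that] by simp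
  qed
  have "inclusion_event M x t L n K = (\<Union>i \<in> {1..n} \<rightarrow>\<^sub>E (UNIV :: nat set).
      {\<omega> \<in> space M. (\<forall>j\<in>{1..n}. \<forall>j'\<in>{1..n}. j < j' \<longrightarrow> t (i j) \<omega> < t (i j') \<omega>)} \<inter>
      {\<omega> \<in> space M. \<forall>j\<in>{1..n}. t (i j) \<omega> \<le> 0 \<and> fit (i j) j \<omega>})" (is "_ = ?R")
  proof (intro set_eqI iffI)
    fix \<omega> assume "\<omega> \<in> inclusion_event M x t L n K"
    then obtain i where \<omega>: "\<omega> \<in> space M" and i: "strict_mono_on {1..n} (\<lambda>j. t (i j) \<omega>)"
      "\<forall>j\<in>{1..n}. t (i j) \<omega> \<le> 0 \<and> K j \<subseteq> interior (visible_part x t L (i j) \<omega>)"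
      by (auto simp: inclusion_event_def)
    then show "\<omega> \<in> ?R"
      by (intro UN_I[of "restrict i {1..n}"]) (auto simp: fit strict_mono_on_def)
  next
    fix \<omega> assume "\<omega> \<in> ?R"
    then show "\<omega> \<in> inclusion_event M x t L n K"
      by (fastforce simp: inclusion_event_def fit strict_mono_on_def)
  qed
  also have "\<dots> \<in> sets M"
    by (intro sets.countable_UN' image_subsetI countable_PiE sets.Int sets.sets_Collect_countable_All' meas)
      (auto intro: countable_finite)
  finally show ?thesis .
qed

section \<open>The dead leaves model\<close>

lemma dead_leaves_marked_poisson:
  assumes X: "random_closed_set P X" and model: "dead_leaves_model M x t L P X"
  shows "marked_poisson_in_time M lborel (distr P fell_borel X) (\<lambda>i \<omega>. (x i \<omega>, t i \<omega>)) L"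
proof -
  let ?N = "distr P fell_borel X"
  have M: "prob_space M" and pp: "poisson_process M lborel (\<lambda>i \<omega>. (x i \<omega>, t i \<omega>))"
    and L: "\<And>i. random_closed_set M (L i)" "\<And>i. distr M fell_borel (L i) = ?N"
    and L_indep: "prob_space.indep_vars M (\<lambda>_. fell_borel) L UNIV"
    and xt_L: "prob_space.indep_set M
       {(\<lambda>\<omega> i. (x i \<omega>, t i \<omega>)) -` A \<inter> space M |A. A \<in> sets (\<Pi>\<^sub>M i\<in>UNIV. lborel)}
       {(\<lambda>\<omega> i. L i \<omega>) -` B \<inter> space M |B. B \<in> sets (\<Pi>\<^sub>M i\<in>UNIV. fell_borel)}"
    using model by (auto simp: dead_leaves_model_def)
  have N: "prob_space ?N"
    using X by (auto simp: random_closed_set_def intro: prob_space.prob_space_distr)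
  interpret M: prob_space M by fact
  interpret N: prob_space ?N by fact
  show ?thesis
  proof (intro marked_poisson_in_time.intro marked_poisson.intro marked_poisson_axioms.intro)
    show "poisson_process M (lborel \<Otimes>\<^sub>M lborel) (\<lambda>i \<omega>. (x i \<omega>, t i \<omega>))"
      using pp by (simp add: lborel_prod)
    show "L i \<in> measurable M ?N" for i using L(1)[of i] by (simp add: random_closed_set_def)
    show "distr M ?N (L i) = ?N" for i
      using L(2)[of i] by (simp cong: distr_cong)
    show "M.indep_vars (\<lambda>_. ?N) L UNIV"
      using L_indep by (simp add: M.indep_vars_def)
    show "M.indep_set
       {(\<lambda>\<omega> i. (x i \<omega>, t i \<omega>)) -` A \<inter> space M |A. A \<in> sets (\<Pi>\<^sub>M i\<in>UNIV. lborel \<Otimes>\<^sub>M lborel)}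
       {(\<lambda>\<omega> i. L i \<omega>) -` B \<inter> space M |B. B \<in> sets (\<Pi>\<^sub>M i\<in>UNIV. ?N)}"
    proof -
      have "sets (\<Pi>\<^sub>M i\<in>(UNIV::nat set). ?N) = sets (\<Pi>\<^sub>M i\<in>UNIV. fell_borel)"
        by (intro sets_PiM_cong) auto
      then show ?thesis using xt_L by (simp only: lborel_prod)
    qed
  qed (use M N in \<open>auto simp: lborel_prod lborel.sigma_finite_measure_axioms\<close>)
qed

theorem proposition5:
  fixes P :: "'p measure" and X :: "'p \<Rightarrow> (real^2) set"
    and M :: "'w measure" and x :: "nat \<Rightarrow> 'w \<Rightarrow> real^2" and t :: "nat \<Rightarrow> 'w \<Rightarrow> real"
    and L :: "nat \<Rightarrow> 'w \<Rightarrow> (real^2) set"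
    and n :: nat and K :: "nat \<Rightarrow> (real^2) set"
  assumes "random_closed_set P X"
    and "AE \<omega> in P. closure (interior (X \<omega>)) = X \<omega>"
    and "condition_C1 P X" and "condition_C2 P X"
    and "dead_leaves_model M x t L P X"
    and "n \<ge> 1"
    and "\<And>j. j \<in> {1..n} \<Longrightarrow> compact (K j) \<and> K j \<noteq> {}"
  shows "inclusion_event M x t L n K \<in> sets M \<and>
    Q_prob M x t L n K = F_fun P X n K / G_fun P X n K"
proof -
  note X = assms(1) and K = assms(7)
  define N where "N = distr P fell_borel X"
  interpret marked_poisson_in_time M lborel N "\<lambda>i \<omega>. (x i \<omega>, t i \<omega>)" L
    unfolding N_def by (rule dead_leaves_marked_poisson[OF X assms(5)])
  have sets_N: "sets N = sets fell_borel" by (simp add: N_def)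
  have sets_LN: "sets (lborel \<Otimes>\<^sub>M N) = sets ((lborel :: (real^2) measure) \<Otimes>\<^sub>M fell_borel)"
    by (intro sets_pair_measure_cong) (simp_all add: sets_N)
  define H where "H k = hitting (cumulative_union K (Suc k))" for k
  define G where "G k = first_covering (K (Suc k)) (cumulative_union K k)" for k
  have comp: "compact (cumulative_union K k)" if "k \<le> n" for k
    using K that by (intro compact_cumulative_union) auto
  have compK: "compact (K (Suc k))" "K (Suc k) \<noteq> {}" if "k < n" for k using K[of "Suc k"] that by auto
  have subK: "K (Suc k) \<subseteq> cumulative_union K (Suc k)" for k
    unfolding cumulative_union_def by (rule UN_upper) simp
  define h where "h k = measure (lborel \<Otimes>\<^sub>M N) (H k)" for k
  define g where "g k = measure (lborel \<Otimes>\<^sub>M N) (G k)" for k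
  have C1: "mean_area P (\<lambda>\<omega>. X \<omega> + reflection C) < \<infinity>" if "compact C" for C
    using assms(3) compact_reflection[OF that] by (simp add: condition_C1_def)
  have H_sets: "H k \<in> sets (lborel \<Otimes>\<^sub>M N)" if "k < n" for k
    unfolding H_def sets_LN using comp that by (intro hitting_measurable) auto
  have H_mean: "emeasure (lborel \<Otimes>\<^sub>M N) (H k) = mean_area P (\<lambda>\<omega>. X \<omega> + reflection (cumulative_union K (Suc k)))"
    if "k < n" for k
    unfolding H_def N_def using comp that by (intro emeasure_hitting X) auto
  have H_fin: "emeasure (lborel \<Otimes>\<^sub>M N) (H k) < \<infinity>" if "k < n" for k
    unfolding H_mean[OF that] using comp that by (intro C1) auto
  have H_h: "emeasure (lborel \<Otimes>\<^sub>M N) (H k) = ennreal (h k)" if "k < n" for k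
    using H_fin[OF that] by (simp add: h_def emeasure_eq_ennreal_measure)
  have h_pos: "0 < h k" if "k < n" for k
  proof -
    have "0 < emeasure (lborel \<Otimes>\<^sub>M N) (H k)"
      unfolding H_mean[OF that] using comp[of "Suc k"] compK[OF that] subK[of k] that
      by (intro mean_area_dilation_pos[OF X assms(4)]) auto
    then show ?thesis by (simp add: H_h[OF that])
  qed
  have G_sets: "G k \<in> sets (lborel \<Otimes>\<^sub>M N)" if "k < n" for k
    unfolding G_def first_covering_def sets_LN using comp compK that
    by (intro sets.Diff hitting_measurable covering_measurable) auto
  have GH: "G k \<subseteq> H k" if kn: "k < n" for k
  proof (rule subrelI)
    fix y F assume yF: "(y, F) \<in> G k"
    obtain p where p: "p \<in> K (Suc k)" using compK(2)[OF kn] by blast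
    moreover have "K (Suc k) \<subseteq> (+) y ` interior F"
      using yF by (simp add: G_def first_covering_def covering_def)
    ultimately have "p \<in> (+) y ` F" "p \<in> cumulative_union K (Suc k)"
      using subK[of k] image_mono[OF interior_subset, of "(+) y" F] by blast+
    then show "(y, F) \<in> H k"
      using yF by (auto simp: G_def H_def first_covering_def covering_def hitting_def)
  qed
  have G_mean: "emeasure (lborel \<Otimes>\<^sub>M N) (G k) = mean_area P (\<lambda>\<omega>.
      (interior (X \<omega>) \<ominus> reflection (K (Suc k))) \<inter> - (X \<omega> + reflection (cumulative_union K k)))"
    if "k < n" for k
    unfolding G_def N_def using comp compK that by (intro emeasure_first_covering X) auto
  have G_g: "emeasure (lborel \<Otimes>\<^sub>M N) (G k) = ennreal (g k)" if "k < n" for k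
  proof -
    have "emeasure (lborel \<Otimes>\<^sub>M N) (G k) \<le> emeasure (lborel \<Otimes>\<^sub>M N) (H k)"
      using GH[OF that] H_sets[OF that] by (rule emeasure_mono)
    then have "emeasure (lborel \<Otimes>\<^sub>M N) (G k) < \<infinity>" using H_fin[OF that] by (rule le_less_trans)
    then show ?thesis by (simp add: g_def emeasure_eq_ennreal_measure)
  qed
  let ?E = "inclusion_event M x t L n K"
  have L: "L i \<in> measurable M fell_borel" for i
    using assms(5) by (simp add: dead_leaves_model_def random_closed_set_def)
  have t: "t i \<in> borel_measurable M" for i
    using time_measurable[of i] by (simp add: time_def)
  have x: "x i \<in> borel_measurable M" for i
    using location_measurable[of i] by simp
  have E: "?E \<in> sets M"
    by (rule inclusion_event_measurable[OF x t L]) (use K in auto)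
  have regular: "AE \<omega> in M. \<forall>i. closure (interior (L i \<omega>)) = L i \<omega>"
    unfolding AE_all_countable
  proof
    fix i
    let ?R = "{F \<in> space fell_borel. closure (interior F) = F} :: (real^2) set set"
    have R: "?R \<in> sets fell_borel"
      using regular_closed_measurable by (simp add: space_fell_borel)
    have "AE F in distr P fell_borel X. closure (interior F) = F"
      using AE_distr_iff[OF _ R, of X P] X assms(2) by (simp add: random_closed_set_def)
    moreover have "distr P fell_borel X = distr M fell_borel (L i)"
      using assms(5) by (simp add: dead_leaves_model_def)
    ultimately have "AE F in distr M fell_borel (L i). closure (interior F) = F" by (simp only:)
    then show "AE \<omega> in M. closure (interior (L i \<omega>)) = L i \<omega>"
      unfolding AE_distr_iff[OF L R] .
  qed
  \<comment> \<open>\<open>E \<nu> (X \<oplus> C) < \<infinity>\<close> makes the leaves near the compact sets locally finite in time.\<close>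
  define W where "W = hitting (unit_neighbourhood (cumulative_union K n))"
  have W_comp: "compact (unit_neighbourhood (cumulative_union K n))"
    using comp by (intro compact_unit_neighbourhood) auto
  have W_sets: "W \<in> sets (lborel \<Otimes>\<^sub>M N)"
    unfolding W_def sets_LN by (rule hitting_measurable[OF W_comp])
  have W_fin: "emeasure (lborel \<Otimes>\<^sub>M N) W < \<infinity>"
    unfolding W_def N_def emeasure_hitting[OF X W_comp] by (rule C1[OF W_comp])
  have locally_finite: "AE \<omega> in M. \<forall>a. finite {i. ((x i \<omega>, t i \<omega>), L i \<omega>) \<in> during {- real a..<0} W}"
    unfolding AE_all_countable
  proof
    fix a
    have "emeasure ((lborel \<Otimes>\<^sub>M lborel) \<Otimes>\<^sub>M N) (during {- real a..<0} W) < \<infinity>"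
      using W_fin W_sets by (subst emeasure_during) (auto simp: ennreal_mult_less_top)
    then show "AE \<omega> in M. finite {i. ((x i \<omega>, t i \<omega>), L i \<omega>) \<in> during {- real a..<0} W}"
      using W_sets by (intro finitely_many_marked_points during_measurable) auto
  qed
  \<comment> \<open>A leaf exactly at time \<open>0\<close> would count as visible, but chains only find leaves before \<open>0\<close>.\<close>
  define Now where "Now = during {0} (space (lborel \<Otimes>\<^sub>M N))"
  have Now: "Now \<in> sets ((lborel \<Otimes>\<^sub>M lborel) \<Otimes>\<^sub>M N)"
    unfolding Now_def by (intro during_measurable sets.top) simp
  have Now_null: "emeasure ((lborel \<Otimes>\<^sub>M lborel) \<Otimes>\<^sub>M N) Now = 0"
    unfolding Now_def by (subst emeasure_during[OF _ sets.top]) auto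
  have "prob (void Now) = exp (- measure ((lborel \<Otimes>\<^sub>M lborel) \<Otimes>\<^sub>M N) Now)"
    by (rule void_probability[OF Now]) (simp add: Now_null)
  then have "prob (void Now) = 1" by (simp add: measure_def Now_null)
  then have nonzero: "AE \<omega> in M. \<omega> \<in> void Now"
    using prob_eq_1[OF void_measurable[OF Now]] by simp
  have chain: "AE \<omega> in M. \<omega> \<in> ?E \<longleftrightarrow> latest_chain (time \<omega>) (of_kind H \<omega>) (of_kind G \<omega>) n 0"
    using regular locally_finite nonzero distinct_times AE_space
  proof eventually_elim
    fix \<omega>
    assume reg: "\<forall>i. closure (interior (L i \<omega>)) = L i \<omega>"
      and fin: "\<forall>a. finite {i. ((x i \<omega>, t i \<omega>), L i \<omega>) \<in> during {- real a..<0} W}"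
      and nz: "\<omega> \<in> void Now"
      and inj: "inj (time \<omega>)" and \<omega>: "\<omega> \<in> space M"
    have cl: "closed (L i \<omega>)" for i
      using measurable_space[OF L \<omega>] by (simp add: space_fell_borel)
    have fin': "finite {i. (x i \<omega>, L i \<omega>) \<in> hitting (unit_neighbourhood (cumulative_union K n)) \<and> t i \<omega> \<in> {a..<0}}" for a
    proof -
      have "- real (nat \<lceil>- a\<rceil>) \<le> a" by linarith
      then have "{i. (x i \<omega>, L i \<omega>) \<in> hitting (unit_neighbourhood (cumulative_union K n)) \<and> t i \<omega> \<in> {a..<0}}
          \<subseteq> {i. ((x i \<omega>, t i \<omega>), L i \<omega>) \<in> during {- real (nat \<lceil>- a\<rceil>)..<0} W}"
        by (auto simp: during_def W_def)
      then show ?thesis using fin finite_subset by blast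
    qed
    have nz': "t i \<omega> \<noteq> 0" for i
      using nz cl by (auto simp: Now_def void_def during_def space_pair_measure N_def space_fell_borel)
    have T: "time \<omega> = (\<lambda>i. t i \<omega>)" by (simp add: time_def fun_eq_iff)
    have "of_kind H \<omega> = (\<lambda>k. {i. (x i \<omega>, L i \<omega>) \<in> hitting (cumulative_union K (Suc k))})"
      "of_kind G \<omega> = (\<lambda>k. {i. (x i \<omega>, L i \<omega>) \<in> first_covering (K (Suc k)) (cumulative_union K k)})"
      by (simp_all add: of_kind_def H_def G_def fun_eq_iff)
    then show "\<omega> \<in> ?E \<longleftrightarrow> latest_chain (time \<omega>) (of_kind H \<omega>) (of_kind G \<omega>) n 0"
      using inclusion_iff_latest_chain[of L \<omega> t x K n, OF cl reg[rule_format] inj[unfolded T] nz' fin' K] \<omega>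
      by (simp add: inclusion_event_def T)
  qed
  have "prob ?E = (\<Prod>k<n. g k / h k)"
    unfolding g_def h_def
  proof (rule latest_chain_probability[where H=H and G=G])
    show "H k \<subseteq> H (Suc k)" for k
      using cumulative_union_mono[of "Suc k" "Suc (Suc k)" K] by (auto simp: H_def hitting_def)
    show "G (Suc k) \<inter> H k = {}" for k by (auto simp: G_def H_def first_covering_def)
  qed (use H_sets H_fin h_pos G_sets GH E chain in \<open>simp_all add: h_def\<close>)
  also have "\<dots> = (\<Prod>k<n. g k) / (\<Prod>k<n. h k)" by (rule prod_dividef)
  finally have prob_E: "prob ?E = (\<Prod>k<n. g k) / (\<Prod>k<n. h k)" .
  have g0: "0 \<le> g k" for k by (simp add: g_def)
  have "G_fun P X n K = (\<Prod>k<n. mean_area P (\<lambda>\<omega>. X \<omega> + reflection (cumulative_union K (Suc k))))"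
    unfolding G_fun_def by (simp add: prod.atLeast1_atMost_eq)
  also have "\<dots> = (\<Prod>k<n. ennreal (h k))"
    by (intro prod.cong refl) (simp add: H_mean[symmetric] H_h)
  also have "\<dots> = ennreal (\<Prod>k<n. h k)"
    by (intro prod_ennreal) (simp add: h_def)
  finally have G_eq: "G_fun P X n K = ennreal (\<Prod>k<n. h k)" .
  define f where "f j = mean_area P (\<lambda>\<omega>.
      (interior (X \<omega>) \<ominus> reflection (K j)) \<inter> - (X \<omega> + reflection (cumulative_union K (j - 1))))" for j
  have "F_fun P X n K = f 1 * (\<Prod>j=2..n. f j)"
    by (simp add: F_fun_def f_def cumulative_union_def reflection_def set_plus_def)
  also have "\<dots> = (\<Prod>j=1..n. f j)"
  proof -
    have "{1..n} = insert 1 {2..n}" using assms(6) by auto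
    then show ?thesis by simp
  qed
  also have "\<dots> = (\<Prod>k<n. f (Suc k))" by (simp add: prod.atLeast1_atMost_eq)
  also have "\<dots> = (\<Prod>k<n. ennreal (g k))"
    by (intro prod.cong refl) (simp add: f_def G_mean[symmetric] G_g)
  also have "\<dots> = ennreal (\<Prod>k<n. g k)"
    by (intro prod_ennreal g0)
  finally have F_eq: "F_fun P X n K = ennreal (\<Prod>k<n. g k)" .
  have "Q_prob M x t L n K = ennreal ((\<Prod>k<n. g k) / (\<Prod>k<n. h k))"
    by (simp add: Q_prob_def emeasure_eq_measure prob_E)
  also have "\<dots> = ennreal (\<Prod>k<n. g k) / ennreal (\<Prod>k<n. h k)"
    using g0 h_pos by (intro divide_ennreal[symmetric] prod_nonneg prod_pos) auto
  finally show ?thesis using E F_eq G_eq by simp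
qed

end
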